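(* Let $\Lambda=\{\lambda_k\}_{k\in I}$ be a regularizable sequence of nonzero complex numbers of order $\mu$ satisfying the standing assumptions of the context, let $m=\lfloor\mu\rfloor$, let $n\ge 1$, and let $z_1,\dots,z_n\in\mathbb{C}\setminus\Lambda$. Then $$ \begin{aligned} D_\Lambda(z_1,\dots,z_n)&=\exp\Bigg(-n\zeta_\Lambda'(0)-\sum_{j=1}^{n}\sum_{\ell=1}^{m}\frac{\mathrm{FP}\,\zeta_\Lambda(\ell)}{\ell}z_j^\ell-\frac1n\sum_{j=1}^{n}\sum_{\ell=2}^{m}\frac{\operatorname{Res}\zeta_\Lambda(\ell)\,H_{\ell-1}}{\ell}z_j^\ell\\ &\qquad\qquad-\frac1n\sum_{1\le j_1<j_2\le n}\sum_{\ell=2}^{m}\sum_{r=1}^{\ell-1}\frac{\operatorname{Res}\zeta_\Lambda(\ell)\,z_{j_1}^{r}z_{j_2}^{\ell-r}}{r(\ell-r)}\Bigg)\prod_{j=1}^{n}\Delta_\Lambda(z_j)\\ &=\prod_{j=1}^{n}D_\Lambda(z_j)\,\exp\Bigg(\Big(1-\frac1n\Big)\sum_{j=1}^{n}\sum_{\ell=2}^{m}\frac{\operatorname{Res}\zeta_\Lambda(\ell)\,H_{\ell-1}}{\ell}z_j^\ell-\frac1n\sum_{1\le j_1<j_2\le n}\sum_{\ell=2}^{m}\sum_{r=1}^{\ell-1}\frac{\operatorname{Res}\zeta_\Lambda(\ell)\,z_{j_1}^{r}z_{j_2}^{\ell-r}}{r(\ell-r)}\Bigg). \end{aligned} $$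
   Context: Standing setting. $\Lambda=\{\lambda_k\}_{k\in I}$ is a countable sequence of nonzero complex numbers whose order $\mu=\inf\{s\in\mathbb{R}:\sum_{k}|\lambda_k|^{-s}<\infty\}$ exists, is finite and positive. Put $\zeta_\Lambda(s)=\sum_k\lambda_k^{-s}$ for $\mathrm{Re}(s)>\mu$ and $\theta_\Lambda(t)=\sum_k e^{-t\lambda_k}$ for $t>0$. It is assumed that these are related by $\zeta_\Lambda(s)=\frac1{\Gamma(s)}\int_0^\infty\theta_\Lambda(t)t^{s-1}\,dt$, and that as $t\to0^+$ there is an asymptotic expansion $\theta_\Lambda(t)\sim\sum_{n\ge0}c_{i_n}t^{i_n}$, with $i_n$ increasing real numbers, $i_0<0$, $i_n\to\infty$, $c_{i_n}$ constants, and $-i_0=\mu$. Under these assumptions $\zeta_\Lambda$ continues meromorphically to $\mathbb{C}$ with at most simple poles, located only at points $s=-i_n$, and is holomorphic at $s=0$. A sequence is called regularizable if its zeta function continues meromorphically to a region containing $s=0$ and is holomorphic at $s=0$; its zeta regularized product is then $\exp(-\zeta'(0))$, $\zeta$ being its zeta function. For $z_1,\dots,z_n\notin\Lambda$, the zeta function of the sequence $\{(\lambda_k-z_1)\cdots(\lambda_k-z_n)\}_k$ is $\zeta_\Lambda(s;z)=\sum_k\prod_{j=1}^n(\lambda_k-z_j)^{-s}$, for $\mathrm{Re}(s)>\mu/n$; this sequence is regularizable, and $D_\Lambda(z_1,\dots,z_n)=\exp(-\partial_s\zeta_\Lambda(0;z))$ denotes its zeta regularized product. For $n=1$ this gives $D_\Lambda(z)$,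 the zeta regularized product of $\{\lambda_k-z\}_k$. Branch convention: $\lambda_k^{-s}=e^{-s\log\lambda_k}$ with the principal logarithm, and $(\lambda_k-z_j)^{-s}=e^{-s\log(\lambda_k-z_j)}$ with $\log(\lambda_k-z_j)=\log\lambda_k+\mathrm{Log}(1-z_j/\lambda_k)$ (principal $\mathrm{Log}$) whenever $|\lambda_k|>|z_j|$; for the finitely many other $k$ any branch is allowed. Weierstrass product: $\Delta_\Lambda(z)=\prod_{k}\left(1-\frac{z}{\lambda_k}\right)\exp\left(\frac{z}{\lambda_k}+\frac{z^2}{2\lambda_k^2}+\dots+\frac{z^m}{m\lambda_k^m}\right)$ with $m=\lfloor\mu\rfloor$. $\mathrm{FP}\,\zeta_\Lambda(\ell)$ is the constant term of the Laurent expansion of $\zeta_\Lambda$ at $\ell$, $\operatorname{Res}\zeta_\Lambda(\ell)$ is its residue at $\ell$ (zero if there is no pole), and $H_n=\sum_{i=1}^n 1/i$. *)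

theory Defs
  imports "HOL-Complex_Analysis.Complex_Analysis" "HOL-Library.Landau_Symbols"
begin

(* The infimum is taken in the extended reals, so that no real number counts as the infimum of a
   set that is empty or unbounded below. *)
definition has_order :: "'i set \<Rightarrow> ('i \<Rightarrow> complex) \<Rightarrow> real \<Rightarrow> bool" where
  "has_order I lam \<mu> \<longleftrightarrow>
     Inf {ereal s |s. (\<lambda>k. norm (lam k) powr (- s)) summable_on I} = ereal \<mu>"

definition zeta_seq :: "'i set \<Rightarrow> ('i \<Rightarrow> complex) \<Rightarrow> complex \<Rightarrow> complex" where
  "zeta_seq I lam s = (\<Sum>\<^sub>\<infinity>k\<in>I. exp (- s * Ln (lam k)))"

definition theta_seq :: "'i set \<Rightarrow> ('i \<Rightarrow> complex) \<Rightarrow> real \<Rightarrow> complex" where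
  "theta_seq I lam t = (\<Sum>\<^sub>\<infinity>k\<in>I. exp (- of_real t * lam k))"

(* f(t) ~ sum_n c_n t^(e_n) as t -> 0+, in the sense of Poincare. *)
definition asymp_expansion_at_0 ::
    "(real \<Rightarrow> complex) \<Rightarrow> (nat \<Rightarrow> complex) \<Rightarrow> (nat \<Rightarrow> real) \<Rightarrow> bool" where
  "asymp_expansion_at_0 f c e \<longleftrightarrow>
     (\<forall>N. (\<lambda>t. f t - (\<Sum>n\<le>N. c n * of_real (t powr e n)))
            \<in> o[at_right 0](\<lambda>t. of_real (t powr e N)))"

(* F is a meromorphic continuation of f, given on the half-plane Re s > a, to the region U. *)
definition mero_continuation ::
    "real \<Rightarrow> (complex \<Rightarrow> complex) \<Rightarrow> complex set \<Rightarrow> (complex \<Rightarrow> complex) \<Rightarrow> bool" where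
  "mero_continuation a f U F \<longleftrightarrow>
     open U \<and> connected U \<and> {s. Re s > a} \<subseteq> U \<and> F meromorphic_on U \<and>
     (\<forall>s. Re s > a \<longrightarrow> F s = f s)"

definition regularizable :: "real \<Rightarrow> (complex \<Rightarrow> complex) \<Rightarrow> bool" where
  "regularizable a f \<longleftrightarrow>
     (\<exists>U F. mero_continuation a f U F \<and> 0 \<in> U \<and> F analytic_on {0})"

(* The zeta regularized product of a sequence whose zeta function on Re s > a is f. *)
definition zeta_reg_prod :: "real \<Rightarrow> (complex \<Rightarrow> complex) \<Rightarrow> complex" where
  "zeta_reg_prod a f =
     exp (- (THE d. \<exists>U F. mero_continuation a f U F \<and> 0 \<in> U \<and> F analytic_on {0} \<and> deriv F 0 = d))"

(* The continuation to the whole plane. meromorphic_on leaves values on a discrete set arbitrary;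
   nicely_meromorphic_on removes removable singularities and so makes the continuation unique. *)
definition zeta_ext :: "'i set \<Rightarrow> ('i \<Rightarrow> complex) \<Rightarrow> real \<Rightarrow> complex \<Rightarrow> complex" where
  "zeta_ext I lam \<mu> =
     (THE F. mero_continuation \<mu> (zeta_seq I lam) UNIV F \<and> F nicely_meromorphic_on UNIV)"

definition FP :: "(complex \<Rightarrow> complex) \<Rightarrow> complex \<Rightarrow> complex" where
  "FP f w = fls_nth (laurent_expansion f w) 0"

(* L k is an admissible value of log (lam k - z). For the finitely many k with |lam k| <= |z|
   every branch is allowed. *)
definition log_branch :: "'i set \<Rightarrow> ('i \<Rightarrow> complex) \<Rightarrow> complex \<Rightarrow> ('i \<Rightarrow> complex) \<Rightarrow> bool" where
  "log_branch I lam z L \<longleftrightarrow>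
     (\<forall>k\<in>I. exp (L k) = lam k - z \<and>
            (norm (lam k) > norm z \<longrightarrow> L k = Ln (lam k) + Ln (1 - z / lam k)))"

(* Zeta function of the sequence of the products over j in J of lam k - z j, where L j k is the
   chosen value of log (lam k - z j). *)
definition shifted_zeta :: "'i set \<Rightarrow> 'j set \<Rightarrow> ('j \<Rightarrow> 'i \<Rightarrow> complex) \<Rightarrow> complex \<Rightarrow> complex" where
  "shifted_zeta I J L s = (\<Sum>\<^sub>\<infinity>k\<in>I. \<Prod>j\<in>J. exp (- s * L j k))"

(* D_Lambda of the points z j with j in J; they enter through the logarithms L. *)
definition D_reg :: "'i set \<Rightarrow> real \<Rightarrow> 'j set \<Rightarrow> ('j \<Rightarrow> 'i \<Rightarrow> complex) \<Rightarrow> complex" where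
  "D_reg I \<mu> J L = zeta_reg_prod (\<mu> / real (card J)) (shifted_zeta I J L)"

(* The library's infinite products are indexed by the naturals; this is the unordered product
   over I, the multiplicative analogue of infsum. *)
definition weierstrass_prod :: "'i set \<Rightarrow> ('i \<Rightarrow> complex) \<Rightarrow> nat \<Rightarrow> complex \<Rightarrow> complex" where
  "weierstrass_prod I lam m z =
     Lim (finite_subsets_at_top I)
       (\<lambda>X. \<Prod>k\<in>X. (1 - z / lam k) * exp (\<Sum>l=1..m. z ^ l / (of_nat l * lam k ^ l)))"

end

theory Submission
  imports Defs
begin

text \<open>
  Splitting the Mellin integral of theta at \<open>t = 1\<close> and subtracting the asymptotic expansion shows
  that \<open>\<zeta>\<close> is \<open>1 / \<Gamma>(s)\<close> times a function with at most simple poles, so its poles are simple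
  and \<open>0\<close> is a regular point. Expanding \<open>\<Prod>\<^sub>j (1 - z\<^sub>j / \<lambda>\<^sub>k) powr (- s) = \<Sum>\<^sub>p a\<^sub>p(s) \<lambda>\<^sub>k powr (- p)\<close>
  gives
  \<open>\<zeta>(s; z) = \<Sum>\<^sub>p\<^sub>\<le>\<^sub>P a\<^sub>p(s) \<zeta>(n s + p) + R\<^sub>P(s)\<close> with \<open>R\<^sub>P\<close> holomorphic for
  \<open>Re s > (\<mu> - P - 1) / n\<close>, which continues \<open>\<zeta>(s; z)\<close> to the whole plane as \<open>P\<close> grows.
  Take \<open>P = m\<close> and differentiate at \<open>0\<close>. The term \<open>p = 0\<close> gives \<open>n \<zeta>'(0)\<close>. For \<open>p \<ge> 1\<close>,
  \<open>a\<^sub>p(s) = (\<Sum>\<^sub>j z\<^sub>j ^ p / p) s + b\<^sub>p s ^ 2 + \<dots>\<close> meets \<open>\<zeta>(n s + p) = Res / (n s) + FP + \<dots>\<close>: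
  the linear coefficient produces the finite parts and \<open>b\<^sub>p / n\<close> the residues. Finally
  \<open>exp (- R\<^sub>m'(0))\<close> is the product of the Weierstrass products. The second formula follows by applying
  the first one to each \<open>z\<^sub>j\<close> separately.
\<close>

section \<open>Differentiation under dominated integrals and sums\<close>

text \<open>Two obstacles shape the development. The regularized product and the continued zeta
  function are definite descriptions over continuations whose values on a discrete set may be
  arbitrary; continuations are therefore compared on punctured neighbourhoods, and values at a point
  are recovered through limits. Moreover finitely many logarithms carry an arbitrary branch, so
  estimates may only concern large \<open>norm (lam k)\<close>; the other terms are controlled by
  being entire in \<open>s\<close>, and exponentiation at the end erases the choice of branch. The
  value \<open>P = m = \<lfloor>\<mu>\<rfloor>\<close> is the least \<open>P\<close> with
  \<open>\<mu> - P - 1 < 0\<close>, that is, with \<open>0\<close> inside the half-plane of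
  \<open>R\<^sub>P\<close>. Harmonic numbers and cross terms have a common origin:
  \<open>b\<^sub>p\<close> is the coefficient of \<open>w ^ p\<close> in \<open>Q(w) ^ 2 / 2\<close>
  with \<open>Q(w) = - (\<Sum>j. Ln (1 - z j * w))\<close>. Its diagonal part gives
  \<open>H\<^sub>p\<^sub>-\<^sub>1 / p\<close> by partial fractions, its off-diagonal part the sum
  over pairs. A single point has no pairs and weight \<open>1\<close> instead of
  \<open>1 / n\<close>, whence the factor \<open>1 - 1 / n\<close> in the second formula.\<close>

lemma has_field_derivative_integral_dominated:
  fixes f :: "complex \<Rightarrow> 'a \<Rightarrow> complex" and h :: "'a \<Rightarrow> real"
  assumes r: "r > 0"
    and meas: "\<And>s. s \<in> ball s0 r \<Longrightarrow> f s \<in> borel_measurable M"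
    and hol: "\<And>x. x \<in> space M \<Longrightarrow> (\<lambda>s. f s x) holomorphic_on ball s0 r"
    and bound: "\<And>s x. s \<in> ball s0 r \<Longrightarrow> x \<in> space M \<Longrightarrow> norm (f s x) \<le> h x"
    and h: "integrable M h"
  shows "integrable M (\<lambda>x. deriv (\<lambda>s. f s x) s0)"
    and "((\<lambda>s. \<integral>x. f s x \<partial>M) has_field_derivative (\<integral>x. deriv (\<lambda>s. f s x) s0 \<partial>M)) (at s0)"
proof -
  define d where "d = (\<lambda>x. deriv (\<lambda>s. f s x) s0)"
  define q where "q = (\<lambda>s x. (f s x - f s0 x) / (s - s0))"
  have int: "integrable M (f s)" if "s \<in> ball s0 r" for s
    by (rule Bochner_Integration.integrable_bound[OF h meas[OF that]])
       (use bound[OF that] in \<open>auto intro!: AE_I2 order.trans[OF _ abs_ge_self]\<close>)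
  have s0: "s0 \<in> ball s0 r" using r by simp
  have derx: "((\<lambda>s. f s x) has_field_derivative deriv (\<lambda>s. f s x) s) (at s)"
    if "x \<in> space M" "s \<in> ball s0 r" for x s
    using holomorphic_derivI[OF hol[OF that(1)] open_ball that(2)] .
  \<comment> \<open>Cauchy's estimate on circles of radius \<open>r/4\<close> around points of the
    half ball bounds the derivative by \<open>4 * h x / r\<close>. The mean value inequality on the
    convex half ball turns this into a bound for the difference quotients that is uniform in
    \<open>s\<close>.\<close>
  have derbound: "norm (deriv (\<lambda>s. f s x) s) \<le> 4 * h x / r"
    if x: "x \<in> space M" and s: "s \<in> ball s0 (r/2)" for x s
  proof -
    have sub: "cball s (r/4) \<subseteq> ball s0 r"
    proof
      fix y assume "y \<in> cball s (r/4)"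
      then show "y \<in> ball s0 r"
        using s dist_triangle[of s0 y s] r by auto
    qed
    have "norm ((deriv ^^ 1) (\<lambda>s. f s x) s) \<le> fact 1 * h x / (r/4) ^ 1"
    proof (rule Cauchy_inequality)
      show "(\<lambda>s. f s x) holomorphic_on ball s (r/4)"
        by (rule holomorphic_on_subset[OF hol[OF x]]) (use sub in auto)
      show "continuous_on (cball s (r/4)) (\<lambda>s. f s x)"
        by (rule continuous_on_subset[OF holomorphic_on_imp_continuous_on[OF hol[OF x]] sub])
      show "norm (f y x) \<le> h x" if "norm (s - y) = r/4" for y
        using that x sub by (intro bound) (auto simp: dist_norm subset_iff)
    qed (use r in auto)
    then show ?thesis using r by (simp add: field_simps)
  qed
  have qbound: "norm (q s x) \<le> 4 * h x / r"
    if x: "x \<in> space M" and s: "s \<in> ball s0 (r/2)" "s \<noteq> s0" for x s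
  proof -
    have "norm (f s x - f s0 x) \<le> (4 * h x / r) * norm (s - s0)"
    proof (rule field_differentiable_bound[of "ball s0 (r/2)"])
      show "((\<lambda>s. f s x) has_field_derivative deriv (\<lambda>s. f s x) y) (at y within ball s0 (r/2))"
        if "y \<in> ball s0 (r/2)" for y
        using derx[OF x, of y] that r by (auto intro: has_field_derivative_at_within)
    qed (use s r derbound[OF x] in auto)
    then show ?thesis using s r by (simp add: q_def norm_divide divide_simps)
  qed
  have lim: "(\<lambda>i. q (X i) x) \<longlonglongrightarrow> d x"
    if x: "x \<in> space M" and X: "\<And>i. X i \<noteq> s0" "X \<longlonglongrightarrow> s0" for x X
  proof -
    have "((\<lambda>s. q s x) \<longlongrightarrow> d x) (at s0)"
      using derx[OF x s0] unfolding has_field_derivative_iff q_def d_def .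
    then show ?thesis using X unfolding tendsto_at_iff_sequentially by (auto simp: o_def)
  qed
  \<comment> \<open>Dominated convergence speaks of sequences, so the limit at \<open>s0\<close> is
    tested along arbitrary sequences in the punctured half ball.\<close>
  have main: "integrable M d \<and> (\<lambda>i. \<integral>x. q (X i) x \<partial>M) \<longlonglongrightarrow> (\<integral>x. d x \<partial>M)"
    if X: "\<And>i. X i \<in> ball s0 (r/2) - {s0}" "X \<longlonglongrightarrow> s0" for X
  proof -
    have mq: "q (X i) \<in> borel_measurable M" for i
      unfolding q_def using meas[OF s0] meas[of "X i"] X(1)[of i] r by (auto intro!: measurable)
    have limx: "x \<in> space M \<Longrightarrow> (\<lambda>i. q (X i) x) \<longlonglongrightarrow> d x" for x
      using lim X by blast
    have md: "d \<in> borel_measurable M"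
      by (rule borel_measurable_LIMSEQ_metric[OF mq limx])
    have hh: "integrable M (\<lambda>x. 4 * h x / r)" using h by simp
    have b: "AE x in M. norm (q (X i) x) \<le> 4 * h x / r" for i
      using qbound X(1)[of i] by (intro AE_I2) auto
    show ?thesis
      using integrable_dominated_convergence[OF md mq hh AE_I2[OF limx] b]
            integral_dominated_convergence[OF md mq hh AE_I2[OF limx] b] by blast
  qed
  \<comment> \<open>One concrete sequence is enough to extract from \<open>main\<close> that the
    derivative is integrable.\<close>
  define Y :: "nat \<Rightarrow> complex" where "Y = (\<lambda>i. s0 + of_real (r/4 * inverse (of_nat (Suc i))))"
  have "Y i \<in> ball s0 (r/2) - {s0}" for i
  proof -
    define y :: real where "y = r/4 * inverse (of_nat (Suc i))"
    have "inverse (of_nat (Suc i)) \<le> (1::real)" by (simp add: field_simps)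
    then have "y < r/2"
      using r mult_left_mono[of "inverse (of_nat (Suc i))" 1 "r/4"] by (simp add: y_def)
    moreover have "y > 0" using r by (simp add: y_def)
    moreover have "Y i = s0 + of_real y" by (simp add: Y_def y_def)
    ultimately show ?thesis by (simp add: dist_norm)
  qed
  moreover have "Y \<longlonglongrightarrow> s0"
  proof -
    have "(\<lambda>i. r/4 * inverse (of_nat (Suc i))) \<longlonglongrightarrow> r/4 * 0"
      by (intro tendsto_mult tendsto_const LIMSEQ_inverse_real_of_nat)
    from tendsto_add[OF tendsto_const[of s0] tendsto_of_real[OF this]] show ?thesis
      unfolding Y_def by simp
  qed
  ultimately show id: "integrable M (\<lambda>x. deriv (\<lambda>s. f s x) s0)"
    using main[of Y] by (auto simp: d_def)
  have "((\<lambda>s. ((\<integral>x. f s x \<partial>M) - (\<integral>x. f s0 x \<partial>M)) / (s - s0)) \<longlongrightarrow> (\<integral>x. d x \<partial>M)) (at s0 within ball s0 (r/2))"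
    unfolding tendsto_at_iff_sequentially
  proof safe
    fix X assume X: "\<forall>i. X i \<in> ball s0 (r/2) - {s0}" "X \<longlonglongrightarrow> s0"
    have "((\<integral>x. f (X i) x \<partial>M) - (\<integral>x. f s0 x \<partial>M)) / (X i - s0) = (\<integral>x. q (X i) x \<partial>M)" for i
    proof -
      have "X i \<in> ball s0 r" using X(1)[rule_format, of i] r unfolding Diff_iff mem_ball by linarith
      from int[OF this] int[OF s0] show ?thesis unfolding q_def by simp
    qed
    then show "((\<lambda>s. ((\<integral>x. f s x \<partial>M) - (\<integral>x. f s0 x \<partial>M)) / (s - s0)) \<circ> X) \<longlonglongrightarrow> (\<integral>x. d x \<partial>M)"
      using main[of X] X by (simp add: o_def)
  qed
  then have "((\<lambda>s. \<integral>x. f s x \<partial>M) has_field_derivative (\<integral>x. d x \<partial>M)) (at s0 within ball s0 (r/2))"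
    unfolding has_field_derivative_iff .
  then show "((\<lambda>s. \<integral>x. f s x \<partial>M) has_field_derivative (\<integral>x. deriv (\<lambda>s. f s x) s0 \<partial>M)) (at s0)"
    using r at_within_open[of s0 "ball s0 (r/2)"] by (simp add: d_def)
qed

text \<open>An absolutely convergent unordered sum is the integral for the counting measure on
  \<open>I\<close>, where every function is measurable, so the statement about integrals
  applies.\<close>

lemma has_field_derivative_infsum_dominated:
  fixes f :: "complex \<Rightarrow> 'i \<Rightarrow> complex" and h :: "'i \<Rightarrow> real"
  assumes r: "r > 0"
    and hol: "\<And>k. k \<in> I \<Longrightarrow> (\<lambda>s. f s k) holomorphic_on ball s0 r"
    and bound: "\<And>s k. s \<in> ball s0 r \<Longrightarrow> k \<in> I \<Longrightarrow> norm (f s k) \<le> h k"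
    and h: "h summable_on I"
  shows "(\<lambda>k. deriv (\<lambda>s. f s k) s0) summable_on I"
    and "((\<lambda>s. \<Sum>\<^sub>\<infinity>k\<in>I. f s k) has_field_derivative (\<Sum>\<^sub>\<infinity>k\<in>I. deriv (\<lambda>s. f s k) s0)) (at s0)"
proof -
  have hpos: "h k \<ge> 0" if "k \<in> I" for k
    using order.trans[OF norm_ge_zero bound[of s0 k]] r that by simp
  have hI: "integrable (count_space I) h"
  proof -
    have "(\<lambda>k. norm (h k)) summable_on I"
      using h by (rule summable_on_cong[THEN iffD1, rotated]) (use hpos in auto)
    then show ?thesis
      unfolding abs_summable_on_def[symmetric] using abs_summable_equivalent[of h I] by blast
  qed
  have eq: "(\<Sum>\<^sub>\<infinity>k\<in>I. g k) = integral\<^sup>L (count_space I) g" "g summable_on I"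
    if "integrable (count_space I) g" for g :: "'i \<Rightarrow> complex"
    using that infsetsum_infsum[of g I] abs_summable_equivalent[of g I] abs_summable_summable[of g I]
    by (simp_all add: abs_summable_on_def infsetsum_def)
  note D = has_field_derivative_integral_dominated[where M = "count_space I" and f = f and h = h,
      OF r _ _ _ hI]
  have d1: "integrable (count_space I) (\<lambda>k. deriv (\<lambda>s. f s k) s0)"
    by (rule D(1)) (use hol bound in auto)
  have d2: "((\<lambda>s. \<integral>k. f s k \<partial>count_space I) has_field_derivative
      (\<integral>k. deriv (\<lambda>s. f s k) s0 \<partial>count_space I)) (at s0)"
    by (rule D(2)) (use hol bound in auto)
  have int: "integrable (count_space I) (f s)" if "s \<in> ball s0 r" for s
    by (rule Bochner_Integration.integrable_bound[OF hI])
       (use bound[OF that] in \<open>auto intro!: AE_I2 order.trans[OF _ abs_ge_self]\<close>)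
  show "(\<lambda>k. deriv (\<lambda>s. f s k) s0) summable_on I"
    using eq(2)[OF d1] .
  show "((\<lambda>s. \<Sum>\<^sub>\<infinity>k\<in>I. f s k) has_field_derivative (\<Sum>\<^sub>\<infinity>k\<in>I. deriv (\<lambda>s. f s k) s0)) (at s0)"
    unfolding eq(1)[OF d1]
  proof (rule has_field_derivative_transform_within_open[OF d2, of "ball s0 r"])
    fix s assume "s \<in> ball s0 r"
    then show "(\<integral>k. f s k \<partial>count_space I) = (\<Sum>\<^sub>\<infinity>k\<in>I. f s k)" using eq(1)[OF int] by simp
  qed (use r in auto)
qed

section \<open>Meromorphic continuation\<close>

text \<open>At a pole both sides are \<open>0\<close> by convention; elsewhere \<open>f\<close>
  already agrees with its limit.\<close>

lemma nicely_meromorphic_on_remove_sings_eq: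
  assumes "f nicely_meromorphic_on A" "z \<in> A"
  shows "remove_sings f z = f z"
  using assms unfolding nicely_meromorphic_on_def by (metis remove_sings_at_pole remove_sings_eqI)

text \<open>The identity theorem is applied to the difference after its removable singularities are
  filled in. As \<open>f\<close> and \<open>g\<close> may have stray values, equality can only be
  claimed on a punctured neighbourhood.\<close>

lemma meromorphic_eq_at:
  assumes f: "f meromorphic_on A" and g: "g meromorphic_on A" and A: "open A" "connected A"
    and B: "open B" "B \<subseteq> A" "z0 \<in> B" "\<And>z. z \<in> B \<Longrightarrow> f z = g z" and z: "z \<in> A"
  shows "\<forall>\<^sub>F w in at z. f w = g w"
proof -
  define d where "d = (\<lambda>z. f z - g z)"
  have d: "d meromorphic_on A" unfolding d_def by (intro meromorphic_intros f g)
  have dz: "remove_sings d w = 0" if "w \<in> B" for w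
  proof -
    have "\<forall>\<^sub>F x in at w. d x = 0"
      using eventually_at_in_open'[OF B(1) that] by eventually_elim (simp add: d_def B(4))
    then show ?thesis by (intro remove_sings_eqI tendsto_eventually)
  qed
  have "\<forall>\<^sub>F x in at z0. remove_sings d x = 0"
    using eventually_at_in_open'[OF B(1,3)] by eventually_elim (simp add: dz)
  then have "\<exists>\<^sub>F x in at z0. remove_sings d x = 0"
    by (intro eventually_frequently) auto
  from frequently_eq_meromorphic_imp_constant[OF this remove_sings_nicely_meromorphic[OF d] A]
  have zero: "remove_sings d w = 0" if "w \<in> A" for w using that B by auto
  have "\<forall>\<^sub>F w in at z. remove_sings d w = d w"
    by (rule eventually_remove_sings_eq_at) (use d z in \<open>auto simp: meromorphic_on_altdef\<close>)
  then show ?thesis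
    using eventually_at_in_open'[OF A(1) z] by eventually_elim (use zero in \<open>auto simp: d_def\<close>)
qed

lemma nicely_meromorphic_eq:
  assumes f: "f nicely_meromorphic_on A" and g: "g nicely_meromorphic_on A"
    and A: "open A" "connected A"
    and B: "open B" "B \<subseteq> A" "z0 \<in> B" "\<And>z. z \<in> B \<Longrightarrow> f z = g z" and z: "z \<in> A"
  shows "f z = g z"
proof -
  have "\<forall>\<^sub>F w in at z. f w = g w"
    by (rule meromorphic_eq_at[OF _ _ A B z]) (use f g in \<open>auto simp: nicely_meromorphic_on_def\<close>)
  then have "remove_sings f z = remove_sings g z" by (intro remove_sings_cong) auto
  then show ?thesis
    using nicely_meromorphic_on_remove_sings_eq[OF f z] nicely_meromorphic_on_remove_sings_eq[OF g z] by simp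
qed

lemma half_plane_Re_gt: "open {s. Re s > a}" "connected {s. Re s > a}"
  by (simp_all add: open_halfspace_Re_gt convex_connected convex_halfspace_Re_gt)

text \<open>\<open>G\<close> takes its value at \<open>s\<close> from the normalized continuation to
  \<open>Re w > Re s - 1\<close>, so that \<open>s\<close> is an interior point. Any two normalized
  continuations agree on the smaller half-plane by the identity theorem, hence near each point
  \<open>G\<close> coincides with a single one of them.\<close>

lemma meromorphic_continuation_glue:
  assumes hol: "f holomorphic_on {s. Re s > a}"
    and ex: "\<And>b. \<exists>F. F meromorphic_on {s. Re s > b} \<and> (\<forall>s. Re s > max a b \<longrightarrow> F s = f s)"
  obtains G where "mero_continuation a f UNIV G" "G nicely_meromorphic_on UNIV"
proof -
  obtain F where F: "\<And>b. F b meromorphic_on {s. Re s > b}"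
    and Ff: "\<And>b s. Re s > max a b \<Longrightarrow> F b s = f s"
    using ex by metis
  have rs: "remove_sings (F b) s = f s" if "Re s > max a b" for b s
  proof -
    have "\<forall>\<^sub>F w in at s. F b w = f w"
      using eventually_at_in_open'[OF half_plane_Re_gt(1), of s "max a b"] that Ff
      by (auto elim: eventually_mono)
    then have "remove_sings (F b) s = remove_sings f s"
      by (intro remove_sings_cong) auto
    also have "f analytic_on {s}"
      using hol that half_plane_Re_gt(1)[of a] by (intro holomorphic_on_imp_analytic_at[OF hol]) auto
    then have "remove_sings f s = f s" by simp
    finally show ?thesis .
  qed
  define G where "G = (\<lambda>s. remove_sings (F (Re s - 1)) s)"
  have G: "G s = remove_sings (F b) s" if "Re s > b" for b s
  proof -
    define c where "c = max b (Re s - 1)"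
    have "remove_sings (F (Re s - 1)) s = remove_sings (F b) s"
    proof (rule nicely_meromorphic_eq[where f = "remove_sings (F (Re s - 1))" and g = "remove_sings (F b)" and A = "{s. Re s > c}"])
      show "remove_sings (F (Re s - 1)) nicely_meromorphic_on {s. Re s > c}"
        by (intro remove_sings_nicely_meromorphic meromorphic_on_subset[OF F]) (auto simp: c_def)
      show "remove_sings (F b) nicely_meromorphic_on {s. Re s > c}"
        by (intro remove_sings_nicely_meromorphic meromorphic_on_subset[OF F]) (auto simp: c_def)
      show "open {s. Re s > max a c}" "open {s. Re s > c}" "connected {s. Re s > c}"
        by (rule half_plane_Re_gt)+
      show "{s. Re s > max a c} \<subseteq> {s. Re s > c}" by auto
      show "of_real (max a c + 1) \<in> {s. Re s > max a c}" by (auto simp: max_def)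
      show "remove_sings (F (Re s - 1)) w = remove_sings (F b) w" if "w \<in> {s. Re s > max a c}" for w
        using that rs[of b w] rs[of "Re s - 1" w] by (auto simp: c_def)
    qed (use that in \<open>auto simp: c_def\<close>)
    then show ?thesis by (simp add: G_def)
  qed
  have "G nicely_meromorphic_on UNIV"
    unfolding nicely_meromorphic_on_def
  proof (intro conjI ballI)
    have ev: "\<forall>\<^sub>F w in at z. G w = remove_sings (F (Re z - 1)) w" for z
      using eventually_at_in_open'[OF half_plane_Re_gt(1), of z "Re z - 1"] G
      by (auto elim: eventually_mono)
    have nice: "remove_sings (F (Re z - 1)) nicely_meromorphic_on {s. Re s > Re z - 1}" for z
      by (intro remove_sings_nicely_meromorphic F)
    have "G meromorphic_on {z}" for z
      using meromorphic_on_cong[of "{z}" G "remove_sings (F (Re z - 1))" "{z}"] ev[of z]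
        remove_sings_meromorphic[OF F[of "Re z - 1"]] meromorphic_on_subset[of _ _ "{z}"] by auto
    then show "G meromorphic_on UNIV" using meromorphic_on_meromorphic_at by blast
    fix z
    have "is_pole (remove_sings (F (Re z - 1))) z \<and> remove_sings (F (Re z - 1)) z = 0 \<or>
        remove_sings (F (Re z - 1)) \<midarrow>z\<rightarrow> remove_sings (F (Re z - 1)) z"
      using nice[of z] unfolding nicely_meromorphic_on_def by auto
    then show "is_pole G z \<and> G z = 0 \<or> G \<midarrow>z\<rightarrow> G z"
      using is_pole_cong[OF ev[of z] refl] tendsto_cong[OF ev[of z]] G[of "Re z - 1" z] by simp
  qed
  moreover from this have "mero_continuation a f UNIV G"
    unfolding mero_continuation_def nicely_meromorphic_on_def
    using G[of a] rs[of a] by auto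
  ultimately show ?thesis using that by blast
qed

section \<open>Uniqueness of continuations and the values of the definite descriptions\<close>

lemma mero_continuation_eq_at:
  assumes F: "mero_continuation a f U F" and G: "mero_continuation a f V G" "U \<subseteq> V" and z: "z \<in> U"
  shows "\<forall>\<^sub>F w in at z. F w = G w"
proof (rule meromorphic_eq_at)
  show "of_real (a + 1) \<in> {s. Re s > a}" by simp
  show "G meromorphic_on U"
    using G meromorphic_on_subset unfolding mero_continuation_def by blast
qed (use F G z half_plane_Re_gt in \<open>auto simp: mero_continuation_def\<close>)

text \<open>Continuations to every region around \<open>0\<close> compete in the definite
  description. Each agrees with \<open>G\<close>, hence with \<open>g\<close>, off \<open>0\<close>;
  being analytic there, it agrees with \<open>g\<close> at \<open>0\<close> as well by continuity,
  so all derivatives coincide. Matching \<open>g\<close> off \<open>0\<close> only allows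
  \<open>g\<close> to be an explicit formula with its singularity cancelled.\<close>

lemma zeta_reg_prod_eq:
  assumes G: "mero_continuation a f UNIV G"
    and g: "g analytic_on {0}" "\<forall>\<^sub>F s in at 0. G s = g s" "G nicely_meromorphic_on UNIV"
  shows "zeta_reg_prod a f = exp (- deriv g 0)"
proof -
  have lim: "g \<midarrow>0\<rightarrow> g 0" using g(1) analytic_at_imp_isCont isContD by blast
  have deriv_eq: "deriv F 0 = deriv g 0"
    if "F analytic_on {0}" "\<forall>\<^sub>F s in at 0. F s = G s" for F
  proof -
    have ev: "\<forall>\<^sub>F s in at 0. F s = g s" using that(2) g(2) by eventually_elim simp
    have "F \<midarrow>0\<rightarrow> F 0" using that(1) analytic_at_imp_isCont isContD by blast
    then have "F \<midarrow>0\<rightarrow> g 0 \<and> F \<midarrow>0\<rightarrow> F 0" using tendsto_cong[OF ev] lim by simp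
    then have "F 0 = g 0" using LIM_unique by blast
    with ev have "\<forall>\<^sub>F s in nhds 0. F s = g s" by (simp add: eventually_nhds_conv_at)
    then show ?thesis by (intro deriv_cong_ev) auto
  qed
  have "\<not> is_pole G 0"
    using is_pole_cong[OF g(2) refl] analytic_at_imp_no_pole[OF g(1)] by simp
  then have Ga: "G analytic_on {0}"
    by (intro nicely_meromorphic_on_imp_analytic_at[OF g(3)]) auto
  have "(THE d. \<exists>U F. mero_continuation a f U F \<and> 0 \<in> U \<and> F analytic_on {0} \<and> deriv F 0 = d) = deriv g 0"
  proof (rule the_equality)
    show "\<exists>U F. mero_continuation a f U F \<and> 0 \<in> U \<and> F analytic_on {0} \<and> deriv F 0 = deriv g 0"
      using G Ga deriv_eq[OF Ga] by (intro exI[of _ UNIV] exI[of _ G]) auto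
    show "d = deriv g 0"
      if "\<exists>U F. mero_continuation a f U F \<and> 0 \<in> U \<and> F analytic_on {0} \<and> deriv F 0 = d" for d
      using that deriv_eq mero_continuation_eq_at[OF _ G subset_UNIV] by blast
  qed
  then show ?thesis by (simp add: zeta_reg_prod_def)
qed

lemma zeta_ext_eq:
  assumes G: "mero_continuation \<mu> (zeta_seq I lam) UNIV G" "G nicely_meromorphic_on UNIV"
  shows "zeta_ext I lam \<mu> = G"
  unfolding zeta_ext_def
proof (rule the_equality)
  fix F assume F: "mero_continuation \<mu> (zeta_seq I lam) UNIV F \<and> F nicely_meromorphic_on UNIV"
  show "F = G"
  proof
    fix z
    have "remove_sings F z = remove_sings G z"
      using mero_continuation_eq_at[of _ _ UNIV F UNIV G z] F G by (intro remove_sings_cong) auto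
    then show "F z = G z"
      using nicely_meromorphic_on_remove_sings_eq[of _ UNIV z] F G by auto
  qed
qed (use G in auto)

section \<open>Mellin transforms\<close>

lemma of_real_powr_pos: "t > 0 \<Longrightarrow> (of_real t :: complex) powr w = exp (w * of_real (ln t))"
  by (simp add: powr_def Ln_of_real)

lemma norm_of_real_powr: "t \<ge> 0 \<Longrightarrow> norm ((of_real t :: complex) powr w) = t powr Re w"
  by (simp add: norm_powr_real_powr)

text \<open>Measurability of \<open>g\<close> is available only through its product with one power
  of \<open>t\<close>. Multiplying by \<open>t powr (s - a)\<close>, continuous on the positive
  axis, changes the exponent.\<close>

lemma mellin_kernel_measurable:
  assumes m: "set_borel_measurable lborel A (\<lambda>t. g t * (of_real t :: complex) powr (a - 1))"
    and A: "A \<subseteq> {0<..}"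
  shows "set_borel_measurable lborel A (\<lambda>t. g t * of_real t powr (s - 1))"
proof -
  have "continuous_on {0<..} (\<lambda>t::real. exp ((s - a) * of_real (ln t)))"
    by (intro continuous_intros) auto
  then have "(\<lambda>t. indicator {0<..} t *\<^sub>R exp ((s - a) * of_real (ln t))) \<in> borel_measurable borel"
    by (intro borel_measurable_continuous_on_indicator) auto
  then have k: "(\<lambda>t. indicator {0<..} t *\<^sub>R exp ((s - a) * of_real (ln t))) \<in> borel_measurable lborel"
    by simp
  have "(\<lambda>t. (indicator A t *\<^sub>R (g t * of_real t powr (a - 1))) *
      (indicator {0<..} t *\<^sub>R exp ((s - a) * of_real (ln t)))) \<in> borel_measurable lborel"
    by (rule borel_measurable_times[OF m[unfolded set_borel_measurable_def] k])
  also have "(\<lambda>t. (indicator A t *\<^sub>R (g t * of_real t powr (a - 1))) *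
      (indicator {0<..} t *\<^sub>R exp ((s - a) * of_real (ln t)))) =
    (\<lambda>t. indicator A t *\<^sub>R (g t * of_real t powr (s - 1)))"
  proof
    fix t
    show "(indicator A t *\<^sub>R (g t * of_real t powr (a - 1))) *
        (indicator {0<..} t *\<^sub>R exp ((s - a) * of_real (ln t))) =
      indicator A t *\<^sub>R (g t * of_real t powr (s - 1))"
    proof (cases "t \<in> A")
      case True
      then have "t > 0" using A by auto
      then show ?thesis using True
        by (simp add: of_real_powr_pos mult.assoc flip: exp_add) (simp add: algebra_simps)
    qed auto
  qed
  finally show ?thesis unfolding set_borel_measurable_def .
qed

text \<open>The integrand with exponent \<open>a\<close> supplies the measurability, the majorant
  \<open>k\<close> the size.\<close>

lemma mellin_set_integrable:
  assumes m: "set_integrable lborel A (\<lambda>t. g t * (of_real t :: complex) powr (a - 1))"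
    and A: "A \<subseteq> {0<..}"
    and k: "set_integrable lborel A k"
    and bound: "\<And>t. t \<in> A \<Longrightarrow> norm (g t) * t powr (Re s - 1) \<le> (k t :: real)"
  shows "set_integrable lborel A (\<lambda>t. g t * of_real t powr (s - 1))"
  unfolding set_integrable_def
proof (rule Bochner_Integration.integrable_bound)
  show "integrable lborel (\<lambda>t. indicator A t *\<^sub>R k t)" using k by (simp add: set_integrable_def)
  have "set_borel_measurable lborel A (\<lambda>t. g t * (of_real t :: complex) powr (a - 1))"
    using m unfolding set_integrable_def set_borel_measurable_def by (rule borel_measurable_integrable)
  from mellin_kernel_measurable[OF this A, of s]
  show "(\<lambda>t. indicator A t *\<^sub>R (g t * of_real t powr (s - 1))) \<in> borel_measurable lborel"
    unfolding set_borel_measurable_def .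
  have "norm (indicator A t *\<^sub>R (g t * of_real t powr (s - 1))) \<le> norm (indicator A t *\<^sub>R k t)" for t
    using bound[of t] A by (auto simp: indicator_def norm_mult norm_of_real_powr)
  then show "AE t in lborel. norm (indicator A t *\<^sub>R (g t * of_real t powr (s - 1))) \<le> norm (indicator A t *\<^sub>R k t)"
    by simp
qed

lemma mellin_set_integrable_mono:
  assumes m: "set_integrable lborel A (\<lambda>t. g t * (of_real t :: complex) powr (a - 1))"
    and A: "A \<subseteq> {0<..}"
    and bound: "\<And>t. t \<in> A \<Longrightarrow> t powr (Re s - 1) \<le> C * t powr (Re a - 1)"
  shows "set_integrable lborel A (\<lambda>t. g t * of_real t powr (s - 1))"
proof (rule mellin_set_integrable[OF m A])
  show "set_integrable lborel A (\<lambda>t. C * norm (g t * (of_real t :: complex) powr (a - 1)))"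
    using set_integrable_norm[OF m] by (intro set_integrable_mult_right) 
  show "norm (g t) * t powr (Re s - 1) \<le> C * norm (g t * (of_real t :: complex) powr (a - 1))"
    if "t \<in> A" for t
    using mult_left_mono[OF bound[OF that] norm_ge_zero[of "g t"]] that A
    by (auto simp: norm_mult norm_of_real_powr mult_ac)
qed

text \<open>In the strip, \<open>t powr (Re s - 1)\<close> is at most
  \<open>t powr (a - 1) + t powr (b - 1)\<close>: the first summand dominates for
  \<open>t \<le> 1\<close>, the second for \<open>t > 1\<close>. The two end integrals thus give one
  majorant for all \<open>s\<close>.\<close>

lemma mellin_holomorphic_on_strip:
  fixes a b :: real
  assumes a: "set_integrable lborel A (\<lambda>t. g t * (of_real t :: complex) powr (of_real a - 1))"
    and b: "set_integrable lborel A (\<lambda>t. g t * (of_real t :: complex) powr (of_real b - 1))"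
    and A: "A \<subseteq> {0<..}"
  shows "(\<lambda>s. LINT t:A|lborel. g t * of_real t powr (s - 1)) holomorphic_on {s. a < Re s \<and> Re s < b}"
proof (rule holomorphic_onI)
  fix s0 assume s0: "s0 \<in> {s. a < Re s \<and> Re s < b}"
  have "open {s. a < Re s \<and> Re s < b}"
    by (intro open_Collect_conj open_halfspace_Re_gt open_halfspace_Re_lt)
  then obtain r where r: "r > 0" "ball s0 r \<subseteq> {s. a < Re s \<and> Re s < b}"
    using s0 open_contains_ball by blast
  define h where "h = (\<lambda>t. indicator A t *\<^sub>R (norm (g t * (of_real t :: complex) powr (of_real a - 1))
    + norm (g t * (of_real t :: complex) powr (of_real b - 1))))"
  have h: "integrable lborel h"
    using set_integral_add(1)[OF set_integrable_norm[OF a] set_integrable_norm[OF b]]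
    unfolding h_def set_integrable_def .
  have D: "((\<lambda>s. \<integral>t. indicator A t *\<^sub>R (g t * of_real t powr (s - 1)) \<partial>lborel) has_field_derivative
      (\<integral>t. deriv (\<lambda>s. indicator A t *\<^sub>R (g t * of_real t powr (s - 1))) s0 \<partial>lborel)) (at s0)"
  proof (rule has_field_derivative_integral_dominated(2)[OF r(1) _ _ _ h])
    fix s assume s: "s \<in> ball s0 r"
    have "set_borel_measurable lborel A (\<lambda>t. g t * (of_real t :: complex) powr (of_real a - 1))"
      using a unfolding set_integrable_def set_borel_measurable_def by (rule borel_measurable_integrable)
    from mellin_kernel_measurable[OF this A, of s]
    show "(\<lambda>t. indicator A t *\<^sub>R (g t * of_real t powr (s - 1))) \<in> borel_measurable lborel"
      unfolding set_borel_measurable_def .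
    fix t
    show "norm (indicator A t *\<^sub>R (g t * of_real t powr (s - 1))) \<le> h t"
    proof (cases "t \<in> A")
      case True
      then have t: "t > 0" using A by auto
      have "t powr (Re s - 1) \<le> t powr (a - 1) + t powr (b - 1)"
      proof (cases "t \<le> 1")
        case True
        have "t powr (Re s - 1) \<le> t powr (a - 1)"
          using t True s r(2) by (intro powr_mono') auto
        then show ?thesis by (simp add: add_increasing2)
      next
        case False
        have "t powr (Re s - 1) \<le> t powr (b - 1)"
          using t False s r(2) by (intro powr_mono) auto
        then show ?thesis by (simp add: add_increasing)
      qed
      from mult_left_mono[OF this norm_ge_zero[of "g t"]] show ?thesis
        using True t by (simp add: h_def norm_mult norm_of_real_powr distrib_left)
    qed (simp add: h_def)
  next
    fix t
    show "(\<lambda>s. indicator A t *\<^sub>R (g t * of_real t powr (s - 1))) holomorphic_on ball s0 r"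
    proof (cases "t \<in> A")
      case True
      then have "t > 0" using A by auto
      then show ?thesis using True by (auto simp: of_real_powr_pos intro!: holomorphic_intros)
    qed simp
  qed
  then show "(\<lambda>s. LINT t:A|lborel. g t * of_real t powr (s - 1)) field_differentiable
      (at s0 within {s. a < Re s \<and> Re s < b})"
    unfolding set_lebesgue_integral_def
    by (meson field_differentiable_at_within field_differentiable_def)
qed

text \<open>Source of all poles: with \<open>w = s + e n\<close>, a term
  \<open>c n * t powr e n\<close> of the expansion contributes
  \<open>c n / (s + e n)\<close>.\<close>

lemma mellin_power:
  assumes w: "Re w > 0"
  shows "set_integrable lborel {0<..<1} (\<lambda>t. (of_real t :: complex) powr (w - 1))"
    and "(LINT t:{0<..<1}|lborel. (of_real t :: complex) powr (w - 1)) = 1 / w"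
proof -
  have iv: "einterval 0 1 = {0<..<1::real}"
    by (metis einterval_eq_Icc one_ereal_def zero_ereal_def)
  \<comment> \<open>The fundamental theorem for nonnegative functions proves integrability of the
    modulus; its complex version further down has integrability as a premise.\<close>
  have R: "set_integrable lborel (einterval 0 1) (\<lambda>t. t powr (Re w - 1))"
  proof (rule interval_integral_FTC_nonneg(1)[where F = "\<lambda>t. t powr Re w / Re w" and A = 0 and B = "1 / Re w"])
    fix x :: real assume x: "0 < ereal x" "ereal x < 1"
    show "((\<lambda>t. t powr Re w / Re w) has_real_derivative x powr (Re w - 1)) (at x)"
      using x w by (auto intro!: derivative_eq_intros)
    show "isCont (\<lambda>t. t powr (Re w - 1)) x" using x by (auto intro!: continuous_intros)
  next
    have "((\<lambda>t. t powr Re w / Re w) \<longlongrightarrow> 0) (at_right 0)"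
      using w by (auto intro!: tendsto_eq_intros simp: eventually_at_filter)
    then show "(((\<lambda>t. t powr Re w / Re w) \<circ> real_of_ereal) \<longlongrightarrow> 0) (at_right 0)"
      unfolding zero_ereal_def ereal_tendsto_simps .
    have "((\<lambda>t. t powr Re w / Re w) \<longlongrightarrow> 1 powr Re w / Re w) (at_left 1)"
      using w by (intro tendsto_intros) auto
    then show "(((\<lambda>t. t powr Re w / Re w) \<circ> real_of_ereal) \<longlongrightarrow> 1 / Re w) (at_left 1)"
      unfolding one_ereal_def ereal_tendsto_simps by simp
  qed auto
  show int: "set_integrable lborel {0<..<1} (\<lambda>t. (of_real t :: complex) powr (w - 1))"
  proof (rule set_integrable_bound[OF R[unfolded iv]])
    have "continuous_on {0<..<1} (\<lambda>t::real. (of_real t :: complex) powr (w - 1))"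
      by (rule continuous_on_eq[where f = "\<lambda>t. exp ((w - 1) * of_real (ln t))"])
         (auto intro!: continuous_intros simp: of_real_powr_pos)
    then show "set_borel_measurable lborel {0<..<1} (\<lambda>t. (of_real t :: complex) powr (w - 1))"
      unfolding set_borel_measurable_def
      using borel_measurable_continuous_on_indicator[of "{0<..<1::real}"] by simp
    show "AE t in lborel. t \<in> {0<..<1} \<longrightarrow> norm ((of_real t :: complex) powr (w - 1)) \<le> norm (t powr (Re w - 1))"
      by (auto simp: norm_of_real_powr)
  qed
  have "(LBINT t=0..1. (of_real t :: complex) powr (w - 1)) = 1 / w - 0"
  proof (rule interval_integral_FTC_integrable[where F = "\<lambda>t. (of_real t :: complex) powr w / w"])
    fix x :: real assume x: "0 < ereal x" "ereal x < 1"
    have "((\<lambda>z. z powr w / w) has_field_derivative (of_real x powr (w - 1))) (at (of_real x))"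
      using x w by (auto intro!: derivative_eq_intros simp: complex_nonpos_Reals_iff)
    then show "((\<lambda>t. (of_real t :: complex) powr w / w) has_vector_derivative of_real x powr (w - 1)) (at x)"
      by (rule has_vector_derivative_real_field)
    show "isCont (\<lambda>t. (of_real t :: complex) powr (w - 1)) x"
      using x by (auto intro!: continuous_intros simp: complex_nonpos_Reals_iff)
  next
    show "set_integrable lborel (einterval 0 1) (\<lambda>t. (of_real t :: complex) powr (w - 1))"
      using int iv by simp
    have "((\<lambda>t. t powr Re w / norm w) \<longlongrightarrow> 0) (at_right 0)"
      using w by (auto intro!: tendsto_eq_intros simp: eventually_at_filter)
    then have "((\<lambda>t. (of_real t :: complex) powr w / w) \<longlongrightarrow> 0) (at_right 0)"
      by (rule Lim_null_comparison[rotated])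
         (auto simp: norm_divide norm_of_real_powr eventually_at_filter)
    then show "(((\<lambda>t. (of_real t :: complex) powr w / w) \<circ> real_of_ereal) \<longlongrightarrow> 0) (at_right 0)"
      unfolding zero_ereal_def ereal_tendsto_simps .
    have "((\<lambda>t. (of_real t :: complex) powr w / w) \<longlongrightarrow> of_real 1 powr w / w) (at_left 1)"
      using w by (intro tendsto_intros) auto
    then show "(((\<lambda>t. (of_real t :: complex) powr w / w) \<circ> real_of_ereal) \<longlongrightarrow> 1 / w) (at_left 1)"
      unfolding one_ereal_def ereal_tendsto_simps by simp
  qed auto
  then show "(LINT t:{0<..<1}|lborel. (of_real t :: complex) powr (w - 1)) = 1 / w"
    by (simp add: interval_lebesgue_integral_def iv)
qed

section \<open>Holomorphy of the Mellin integral near infinity and its poles from the behaviour near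
  zero\<close>

lemma holomorphic_on_half_plane_strips:
  assumes "\<And>s0. Re s0 > c \<Longrightarrow> \<exists>a b. a < Re s0 \<and> Re s0 < b \<and> f holomorphic_on {s. a < Re s \<and> Re s < b}"
  shows "f holomorphic_on {s. Re s > c}"
proof (rule holomorphic_onI)
  fix s0 assume "s0 \<in> {s. Re s > c}"
  then obtain a b where ab: "a < Re s0" "Re s0 < b" "f holomorphic_on {s. a < Re s \<and> Re s < b}"
    using assms by blast
  have "open {s. a < Re s \<and> Re s < b}"
    by (intro open_Collect_conj open_halfspace_Re_gt open_halfspace_Re_lt)
  then have "f field_differentiable (at s0)"
    using ab by (intro holomorphic_on_imp_differentiable_at[of f]) auto
  then show "f field_differentiable (at s0 within {s. Re s > c})"
    by (rule field_differentiable_at_within)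
qed

text \<open>For \<open>t \<ge> 1\<close> lowering \<open>Re s\<close> only decreases the integrand.
  Convergence for large real part therefore spreads to all of the plane, and \<open>c\<close> is
  arbitrary.\<close>

lemma mellin_tail_holomorphic:
  assumes int: "\<And>s. Re s > \<mu> \<Longrightarrow> set_integrable lborel {0<..} (\<lambda>t. g t * (of_real t :: complex) powr (s - 1))"
  shows "(\<lambda>s. LINT t:{1..}|lborel. g t * of_real t powr (s - 1)) holomorphic_on {s. Re s > c}"
proof (rule holomorphic_on_half_plane_strips)
  fix s0 :: complex
  define b where "b = max (Re s0) \<mu> + 1"
  have b: "set_integrable lborel {1..} (\<lambda>t. g t * (of_real t :: complex) powr (of_real b - 1))"
    by (rule set_integrable_subset[OF int[of "of_real b"]]) (auto simp: b_def)
  have a: "set_integrable lborel {1..} (\<lambda>t. g t * (of_real t :: complex) powr (of_real (Re s0 - 1) - 1))"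
    by (rule mellin_set_integrable_mono[OF b, of _ 1]) (auto simp: b_def intro!: powr_mono)
  show "\<exists>a b. a < Re s0 \<and> Re s0 < b \<and>
      (\<lambda>s. LINT t:{1..}|lborel. g t * of_real t powr (s - 1)) holomorphic_on {s. a < Re s \<and> Re s < b}"
    by (rule exI[of _ "Re s0 - 1"], rule exI[of _ b])
       (use mellin_holomorphic_on_strip[OF a b] in \<open>auto simp: b_def subset_eq\<close>)
qed

text \<open>After subtraction the error is \<open>O(t powr e N)\<close> at \<open>0\<close>, so its
  transform over \<open>(0,1)\<close> converges for \<open>Re s > - e N\<close>. All
  \<open>- e n\<close> are at most \<open>\<mu>\<close>, hence the subtracted powers may be
  integrated explicitly as soon as \<open>Re s > \<mu>\<close>.\<close>

lemma mellin_expansion: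
  assumes int: "\<And>s. Re s > \<mu> \<Longrightarrow> set_integrable lborel {0<..} (\<lambda>t. g t * (of_real t :: complex) powr (s - 1))"
    and ex: "asymp_expansion_at_0 g c e" and e: "strict_mono e" "- e 0 = \<mu>"
  shows "\<exists>H. H holomorphic_on {s. Re s > - e N} \<and> (\<forall>s. Re s > \<mu> \<longrightarrow>
    (LINT t:{0<..}|lborel. g t * of_real t powr (s - 1)) = (\<Sum>n\<le>N. c n / (s + of_real (e n))) + H s)"
proof -
  define h where "h = (\<lambda>t. g t - (\<Sum>n\<le>N. c n * of_real (t powr e n)))"
  have e_ge: "- e n \<le> \<mu>" for n
    using e strict_mono_less_eq[OF e(1), of 0 n] by simp
  have h_eq: "h t * of_real t powr (s - 1) =
      g t * of_real t powr (s - 1) - (\<Sum>n\<le>N. c n * of_real t powr (s + of_real (e n) - 1))"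
    if "t \<in> {0<..<1}" for t s
  proof -
    have "of_real (t powr x) * (of_real t :: complex) powr (s - 1) = of_real t powr (s + of_real x - 1)" for x
      using that by (simp add: of_real_powr_pos powr_def exp_add[symmetric] algebra_simps Ln_of_real flip: exp_of_real)
    then show ?thesis by (simp add: h_def left_diff_distrib sum_distrib_right mult.assoc)
  qed
  have head: "set_integrable lborel {0<..<1} (\<lambda>t. h t * (of_real t :: complex) powr (s - 1))"
    "(LINT t:{0<..<1}|lborel. g t * of_real t powr (s - 1)) =
      (\<Sum>n\<le>N. c n / (s + of_real (e n))) + (LINT t:{0<..<1}|lborel. h t * of_real t powr (s - 1))"
    if s: "Re s > \<mu>" for s
  proof -
    have gi: "set_integrable lborel {0<..<1} (\<lambda>t. g t * (of_real t :: complex) powr (s - 1))"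
      by (rule set_integrable_subset[OF int[OF s]]) auto
    have pw: "Re (s + of_real (e n)) > 0" for n using s e_ge[of n] by simp
    have si: "set_integrable lborel {0<..<1} (\<lambda>t. \<Sum>n\<le>N. c n * (of_real t :: complex) powr (s + of_real (e n) - 1))"
      using mellin_power(1)[OF pw] unfolding set_integrable_def scaleR_sum_right
      by (intro Bochner_Integration.integrable_sum) (simp add: mult_scaleR_right[symmetric] del: mult_scaleR_right)
    have sv: "(LINT t:{0<..<1}|lborel. \<Sum>n\<le>N. c n * (of_real t :: complex) powr (s + of_real (e n) - 1))
        = (\<Sum>n\<le>N. c n / (s + of_real (e n)))"
    proof -
      have "(LINT t:{0<..<1}|lborel. \<Sum>n\<le>N. c n * (of_real t :: complex) powr (s + of_real (e n) - 1))
        = (\<Sum>n\<le>N. LINT t:{0<..<1}|lborel. c n * (of_real t :: complex) powr (s + of_real (e n) - 1))"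
        unfolding set_lebesgue_integral_def scaleR_sum_right
        using set_integrable_mult_right[OF mellin_power(1)[OF pw]]
        by (intro Bochner_Integration.integral_sum) (simp add: set_integrable_def)
      also have "\<dots> = (\<Sum>n\<le>N. c n / (s + of_real (e n)))"
        by (simp add: mellin_power(2)[OF pw])
      finally show ?thesis .
    qed
    have cong: "set_integrable lborel {0<..<1} (\<lambda>t. h t * (of_real t :: complex) powr (s - 1)) \<longleftrightarrow>
      set_integrable lborel {0<..<1} (\<lambda>t. g t * of_real t powr (s - 1) - (\<Sum>n\<le>N. c n * of_real t powr (s + of_real (e n) - 1)))"
      by (rule set_integrable_cong) (use h_eq in auto)
    show "set_integrable lborel {0<..<1} (\<lambda>t. h t * (of_real t :: complex) powr (s - 1))"
      unfolding cong by (rule set_integral_diff(1)[OF gi si])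
    have "(LINT t:{0<..<1}|lborel. h t * of_real t powr (s - 1)) =
        (LINT t:{0<..<1}|lborel. g t * of_real t powr (s - 1) - (\<Sum>n\<le>N. c n * of_real t powr (s + of_real (e n) - 1)))"
      by (rule set_lebesgue_integral_cong) (use h_eq in auto)
    then show "(LINT t:{0<..<1}|lborel. g t * of_real t powr (s - 1)) =
      (\<Sum>n\<le>N. c n / (s + of_real (e n))) + (LINT t:{0<..<1}|lborel. h t * of_real t powr (s - 1))"
      by (simp add: set_integral_diff(2)[OF gi si] sv)
  qed
  have "(\<lambda>t. h t) \<in> o[at_right 0](\<lambda>t. of_real (t powr e N))"
    using ex unfolding asymp_expansion_at_0_def h_def by blast
  from landau_o.smallD[OF this, of 1]
  have "\<forall>\<^sub>F t in at_right 0. norm (h t) \<le> t powr e N" by simp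
  then obtain d0 where d0: "d0 > 0" "\<And>t. 0 < t \<Longrightarrow> t < d0 \<Longrightarrow> norm (h t) \<le> t powr e N"
    unfolding eventually_at_right_field by auto
  define d where "d = min d0 (1/2)"
  have d: "d > 0" "d < 1" "\<And>t. 0 < t \<Longrightarrow> t < d \<Longrightarrow> norm (h t) \<le> t powr e N"
    using d0 by (auto simp: d_def)
  \<comment> \<open>The bound by \<open>t powr e N\<close> holds only on \<open>(0,d)\<close>. On
    \<open>[d,1)\<close> powers of \<open>t\<close> with different exponents are comparable, so
    integrability is carried over from the exponent \<open>b = \<mu> + 1\<close>.\<close>
  have head_low: "set_integrable lborel {0<..<1} (\<lambda>t. h t * (of_real t :: complex) powr (of_real a - 1))"
    if a: "a > - e N" for a
  proof -
    define b where "b = \<mu> + 1"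
    have B: "set_integrable lborel {0<..<1} (\<lambda>t. h t * (of_real t :: complex) powr (of_real b - 1))"
      by (rule head(1)) (simp add: b_def)
    have "set_integrable lborel {0<..<d} (\<lambda>t. h t * (of_real t :: complex) powr (of_real a - 1))"
    proof (rule mellin_set_integrable)
      show "set_integrable lborel {0<..<d} (\<lambda>t. h t * (of_real t :: complex) powr (of_real b - 1))"
        by (rule set_integrable_subset[OF B]) (use d in auto)
      have "set_integrable lborel {0<..<1} (\<lambda>t. norm ((of_real t :: complex) powr (of_real (a + e N) - 1)))"
        by (intro set_integrable_norm mellin_power(1)) (use a in auto)
      then show "set_integrable lborel {0<..<d} (\<lambda>t. norm ((of_real t :: complex) powr (of_real (a + e N) - 1)))"
        by (rule set_integrable_subset) (use d in auto)
      fix t assume t: "t \<in> {0<..<d}"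
      have "norm (h t) * t powr (a - 1) \<le> t powr e N * t powr (a - 1)"
        using d(3)[of t] t by (intro mult_right_mono) auto
      then show "norm (h t) * t powr (Re (of_real a) - 1) \<le> norm ((of_real t :: complex) powr (of_real (a + e N) - 1))"
        using t by (simp add: norm_of_real_powr powr_add[symmetric] algebra_simps)
    qed auto
    moreover have "set_integrable lborel {d..<1} (\<lambda>t. h t * (of_real t :: complex) powr (of_real a - 1))"
    proof (rule mellin_set_integrable_mono)
      show "set_integrable lborel {d..<1} (\<lambda>t. h t * (of_real t :: complex) powr (of_real b - 1))"
        by (rule set_integrable_subset[OF B]) (use d in auto)
      fix t assume t: "t \<in> {d..<1}"
      \<comment> \<open>On \<open>[d,1)\<close> the power is at most \<open>1\<close> if
        \<open>a \<ge> b\<close> and at most \<open>d powr (a - b)\<close> otherwise; the sum covers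
        both cases.\<close>
      have "t powr (a - b) \<le> d powr (a - b) + 1"
      proof (cases "a \<ge> b")
        case True
        then have "t powr (a - b) \<le> 1" using t d by (intro powr_le1) auto
        then show ?thesis by (simp add: add_increasing)
      next
        case False
        then have "t powr (a - b) \<le> d powr (a - b)" using t d by (intro powr_mono2') auto
        then show ?thesis by simp
      qed
      then have "t powr (a - b) * t powr (b - 1) \<le> (d powr (a - b) + 1) * t powr (b - 1)"
        by (intro mult_right_mono) auto
      then show "t powr (Re (of_real a) - 1) \<le> (d powr (a - b) + 1) * t powr (Re (of_real b) - 1)"
        using t d by (simp add: powr_add[symmetric])
    qed (use d in auto)
    ultimately have "set_integrable lborel ({0<..<d} \<union> {d..<1}) (\<lambda>t. h t * (of_real t :: complex) powr (of_real a - 1))"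
      by (intro set_integrable_Un) auto
    also have "{0<..<d} \<union> {d..<1} = {0<..<1}" using d by auto
    finally show ?thesis .
  qed
  have hol: "(\<lambda>s. LINT t:{0<..<1}|lborel. h t * of_real t powr (s - 1)) holomorphic_on {s. Re s > - e N}"
  proof (rule holomorphic_on_half_plane_strips)
    fix s0 assume s0: "Re s0 > - e N"
    \<comment> \<open>The left edge is the midpoint of \<open>- e N\<close> and
      \<open>Re s0\<close>.\<close>
    show "\<exists>a b. a < Re s0 \<and> Re s0 < b \<and>
      (\<lambda>s. LINT t:{0<..<1}|lborel. h t * of_real t powr (s - 1)) holomorphic_on {s. a < Re s \<and> Re s < b}"
      by (rule exI[of _ "(Re s0 - e N) / 2"], rule exI[of _ "Re s0 + 1"])
         (use mellin_holomorphic_on_strip[OF head_low head_low, of "(Re s0 - e N) / 2" "Re s0 + 1"] s0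
          in \<open>auto simp: field_simps subset_eq\<close>)
  qed
  define H where "H = (\<lambda>s. (LINT t:{0<..<1}|lborel. h t * of_real t powr (s - 1)) +
      (LINT t:{1..}|lborel. g t * of_real t powr (s - 1)))"
  show ?thesis
  proof (intro exI[of _ H] conjI allI impI)
    show "H holomorphic_on {s. Re s > - e N}"
      unfolding H_def by (intro holomorphic_on_add hol mellin_tail_holomorphic[OF int])
    fix s assume s: "Re s > \<mu>"
    have U: "{0<..} = {0<..<1} \<union> {1::real..}" by auto
    have i1: "set_integrable lborel {0<..<1} (\<lambda>t. g t * (of_real t :: complex) powr (s - 1))"
      by (rule set_integrable_subset[OF int[OF s]]) auto
    have i2: "set_integrable lborel {1..} (\<lambda>t. g t * (of_real t :: complex) powr (s - 1))"
      by (rule set_integrable_subset[OF int[OF s]]) auto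
    have "(LINT t:{0<..}|lborel. g t * of_real t powr (s - 1)) =
      (LINT t:{0<..<1}|lborel. g t * of_real t powr (s - 1)) + (LINT t:{1..}|lborel. g t * of_real t powr (s - 1))"
      unfolding U by (rule set_integral_Un[OF _ i1 i2]) auto
    then show "(LINT t:{0<..}|lborel. g t * of_real t powr (s - 1)) = (\<Sum>n\<le>N. c n / (s + of_real (e n))) + H s"
      by (simp add: head(2)[OF s] H_def)
  qed
qed

section \<open>The zeta function of a sequence of finite order\<close>

text \<open>The Laurent series is \<open>\<rho>\<close> over the variable plus the Taylor series of
  \<open>h\<close>, so its constant term is the value of the regular part.\<close>

lemma simple_pole_residue_FP:
  assumes h: "h analytic_on {p}" and Z: "\<forall>\<^sub>F s in at p. Z s = \<rho> / (s - p) + h s"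
  shows "residue Z p = \<rho>" and "FP Z p = h p"
proof -
  have h': "(\<lambda>x. h (p + x)) has_fps_expansion fps_expansion h p"
    by (rule analytic_at_imp_has_fps_expansion[OF h])
  then have hl: "(\<lambda>x. h (p + x)) has_laurent_expansion fps_to_fls (fps_expansion h p)"
    and h0: "fps_nth (fps_expansion h p) 0 = h p"
    using has_fps_expansion_to_laurent by (auto simp: fps_expansion_def)
  have "(\<lambda>x. \<rho> * inverse x + h (p + x)) has_laurent_expansion
      (fls_const \<rho> * fls_X_inv + fps_to_fls (fps_expansion h p))"
    by (intro laurent_expansion_intros hl)
  moreover have "\<forall>\<^sub>F x in at 0. Z (p + x) = \<rho> * inverse x + h (p + x)"
    using Z by (simp add: at_to_0' eventually_filtermap field_simps add.commute)
  ultimately have *: "(\<lambda>x. Z (p + x)) has_laurent_expansion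
      (fls_const \<rho> * fls_X_inv + fps_to_fls (fps_expansion h p))"
    by (subst has_laurent_expansion_cong) auto
  show "residue Z p = \<rho>" using has_laurent_expansion_residue[OF *] by (simp add: fls_X_inv_def)
  show "FP Z p = h p" using laurent_expansion_eqI[OF *] h0 by (simp add: FP_def)
qed

text \<open>The principal argument is at most \<open>pi\<close> in modulus, so it costs only a
  factor independent of \<open>w\<close>. Convergence then depends on \<open>norm w\<close>
  alone.\<close>

lemma norm_exp_mult_Ln_le:
  assumes "w \<noteq> 0"
  shows "norm (exp (- s * Ln w)) \<le> norm w powr (- Re s) * exp (pi * \<bar>Im s\<bar>)"
proof -
  have "norm (exp (- s * Ln w)) = norm w powr (- Re s) * exp (Im s * Im (Ln w))"
    using assms by (simp add: norm_exp_eq_Re powr_def exp_add[symmetric] Re_Ln)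
  moreover have "Im s * Im (Ln w) \<le> pi * \<bar>Im s\<bar>"
  proof -
    have "\<bar>Im (Ln w)\<bar> \<le> pi" using Im_Ln_le_pi[OF assms] mpi_less_Im_Ln[OF assms] by simp
    then have "\<bar>Im s\<bar> * \<bar>Im (Ln w)\<bar> \<le> \<bar>Im s\<bar> * pi" by (intro mult_left_mono) auto
    moreover have "Im s * Im (Ln w) \<le> \<bar>Im s\<bar> * \<bar>Im (Ln w)\<bar>" by (metis abs_ge_self abs_mult)
    ultimately show ?thesis by (simp add: mult.commute)
  qed
  ultimately show ?thesis by (simp add: mult_left_mono)
qed

locale sequence_of_order =
  fixes I :: "'i set" and lam :: "'i \<Rightarrow> complex" and \<mu> :: real
  assumes nonzero: "\<And>k. k \<in> I \<Longrightarrow> lam k \<noteq> 0"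
    and order: "has_order I lam \<mu>" and order_pos: "\<mu> > 0"
begin

text \<open>As the infimum is \<open>\<mu>\<close>, some summable exponent exists, and it is at
  least \<open>\<mu> > 0\<close>. Infinitely many \<open>lam k\<close> in a disc of radius
  \<open>R\<close> would then give infinitely many terms bounded below by a positive power of
  \<open>R\<close>.\<close>

lemma finite_norm_le: "finite {k \<in> I. norm (lam k) \<le> R}"
  and summable_norm_powr: "\<sigma> > \<mu> \<Longrightarrow> (\<lambda>k. norm (lam k) powr (- \<sigma>)) summable_on I"
proof -
  let ?S = "{s. (\<lambda>k. norm (lam k) powr (- s)) summable_on I}"
  have inf: "Inf (ereal ` ?S) = ereal \<mu>"
    using order unfolding has_order_def by (simp add: setcompr_eq_image)
  have fin: "finite {k \<in> I. norm (lam k) \<le> R}" if s: "s \<in> ?S" "s > 0" for s R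
  proof (rule ccontr)
    assume infi: "infinite {k \<in> I. norm (lam k) \<le> R}" (is "infinite ?K")
    then have "?K \<noteq> {}" by (metis finite.emptyI)
    then obtain k0 where "k0 \<in> ?K" by blast
    then have R: "R > 0" using nonzero[of k0] by (auto intro: less_le_trans[of 0 "norm (lam k0)"])
    have "(\<lambda>k. norm (lam k) powr (- s)) summable_on ?K"
      using s(1) by (auto intro: summable_on_subset_banach)
    then have "(\<lambda>k. R powr (- s)) summable_on ?K"
    proof (rule summable_on_comparison_test)
      show "R powr - s \<le> norm (lam k) powr - s" if "k \<in> ?K" for k
        using that s nonzero by (intro powr_mono2') auto
    qed auto
    then show False using infi R summable_on_iff_abs_summable_on_real
      by (metis infsum_diverge_constant less_irrefl powr_gt_zero)
  qed
  obtain s1 where s1: "s1 \<in> ?S" "s1 > 0"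
  proof -
    have "Inf (ereal ` ?S) < ereal (\<mu> + 1)" unfolding inf by simp
    then obtain s where s: "s \<in> ?S" unfolding Inf_less_iff by blast
    have "ereal \<mu> \<le> ereal s" unfolding inf[symmetric] using s by (intro Inf_lower) auto
    then show ?thesis using that s order_pos by simp
  qed
  show "finite {k \<in> I. norm (lam k) \<le> R}" by (rule fin[OF s1])
  show "(\<lambda>k. norm (lam k) powr (- \<sigma>)) summable_on I" if "\<sigma> > \<mu>"
  proof -
    have "Inf (ereal ` ?S) < ereal \<sigma>" unfolding inf using that by simp
    then obtain s where s: "s \<in> ?S" "s < \<sigma>" unfolding Inf_less_iff by auto
    \<comment> \<open>Raising the exponent decreases a term only when
      \<open>norm (lam k) > 1\<close>; the exceptions form a finite set.\<close>
    let ?K = "{k \<in> I. norm (lam k) \<le> 1}"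
    have "(\<lambda>k. norm (lam k) powr (- \<sigma>)) summable_on (I - ?K)"
    proof (rule summable_on_comparison_test)
      show "(\<lambda>k. norm (lam k) powr (- s)) summable_on (I - ?K)"
        using s(1) by (auto intro: summable_on_subset_banach)
      show "norm (lam k) powr - \<sigma> \<le> norm (lam k) powr - s" if "k \<in> I - ?K" for k
        using that s by (intro powr_mono) auto
    qed auto
    moreover have "(\<lambda>k. norm (lam k) powr (- \<sigma>)) summable_on ?K"
      using fin[OF s1] by (intro summable_on_finite)
    ultimately have "(\<lambda>k. norm (lam k) powr (- \<sigma>)) summable_on ((I - ?K) \<union> ?K)"
      by (rule summable_on_Un_disjoint) auto
    also have "(I - ?K) \<union> ?K = I" by auto
    finally show ?thesis .
  qed
qed

text \<open>A decay estimate is required only for \<open>norm (lam k) > R\<close>. The finitely many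
  remaining terms are bounded on the closed ball by compactness, which gives a summable majorant
  \<open>h\<close> for all indices together.\<close>

lemma infsum_entire:
  fixes f :: "complex \<Rightarrow> 'i \<Rightarrow> complex"
  assumes hol: "\<And>k. k \<in> I \<Longrightarrow> (\<lambda>s. f s k) holomorphic_on UNIV"
    and r: "r > 0" and \<sigma>: "\<sigma> > \<mu>"
    and bound: "\<And>s k. s \<in> ball s0 r \<Longrightarrow> k \<in> I \<Longrightarrow> norm (lam k) > R \<Longrightarrow>
      norm (f s k) \<le> C * norm (lam k) powr (- \<sigma>)"
  shows "f s0 summable_on I"
    and "(\<lambda>k. deriv (\<lambda>s. f s k) s0) summable_on I"
    and "((\<lambda>s. \<Sum>\<^sub>\<infinity>k\<in>I. f s k) has_field_derivative (\<Sum>\<^sub>\<infinity>k\<in>I. deriv (\<lambda>s. f s k) s0)) (at s0)"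
proof -
  let ?K = "{k \<in> I. norm (lam k) \<le> R}"
  have "\<exists>B. \<forall>s\<in>cball s0 r. norm (f s k) \<le> B" if "k \<in> I" for k
  proof -
    have "continuous_on (cball s0 r) (\<lambda>s. f s k)"
      using holomorphic_on_imp_continuous_on[OF hol[OF that]] by (rule continuous_on_subset) simp
    then have "bounded ((\<lambda>s. f s k) ` cball s0 r)"
      by (intro compact_imp_bounded compact_continuous_image) auto
    then show ?thesis unfolding bounded_iff by auto
  qed
  then obtain B where B: "\<And>k s. k \<in> I \<Longrightarrow> s \<in> cball s0 r \<Longrightarrow> norm (f s k) \<le> B k"
    by metis
  define h where "h = (\<lambda>k. if norm (lam k) \<le> R then B k else C * norm (lam k) powr (- \<sigma>))"
  have "h summable_on (I - ?K)"
  proof -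
    have "(\<lambda>k. C * norm (lam k) powr (- \<sigma>)) summable_on (I - ?K)"
      using summable_on_cmult_right[OF summable_norm_powr[OF \<sigma>], of C]
      by (auto intro: summable_on_subset_banach)
    then show ?thesis by (rule summable_on_cong[THEN iffD1, rotated]) (auto simp: h_def)
  qed
  moreover have "h summable_on ?K" using finite_norm_le by (intro summable_on_finite)
  ultimately have "h summable_on ((I - ?K) \<union> ?K)" by (rule summable_on_Un_disjoint) auto
  also have "(I - ?K) \<union> ?K = I" by auto
  finally have h: "h summable_on I" .
  have bnd: "norm (f s k) \<le> h k" if "s \<in> ball s0 r" "k \<in> I" for s k
    using B[of k s] bound[of s k] that by (auto simp: h_def)
  note D = has_field_derivative_infsum_dominated[where f = f and I = I, OF r _ bnd h]
  have hol': "(\<lambda>s. f s k) holomorphic_on ball s0 r" if "k \<in> I" for k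
    by (rule holomorphic_on_subset[OF hol[OF that]]) simp
  show "f s0 summable_on I"
  proof (rule abs_summable_summable)
    show "(\<lambda>k. norm (f s0 k)) summable_on I"
      by (rule Infinite_Sum.abs_summable_on_comparison_test'[OF h]) (use bnd r in simp)
  qed
  show "(\<lambda>k. deriv (\<lambda>s. f s k) s0) summable_on I"
    and "((\<lambda>s. \<Sum>\<^sub>\<infinity>k\<in>I. f s k) has_field_derivative (\<Sum>\<^sub>\<infinity>k\<in>I. deriv (\<lambda>s. f s k) s0)) (at s0)"
    using D hol' by blast+
qed

lemma zeta_seq_terms:
  assumes s0: "Re s0 > \<mu>"
  shows "(\<lambda>k. exp (- s0 * Ln (lam k))) summable_on I"
    and "zeta_seq I lam field_differentiable (at s0)"
proof -
  \<comment> \<open>Half the distance to the line \<open>Re s = \<mu>\<close>, so that exponents in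
    the ball stay above \<open>Re s0 - r > \<mu>\<close>; \<open>C\<close> absorbs the argument
    factor.\<close>
  define r where "r = (Re s0 - \<mu>) / 2"
  define C where "C = exp (pi * (\<bar>Im s0\<bar> + r))"
  have r: "r > 0" and \<sigma>: "Re s0 - r > \<mu>" using s0 by (auto simp: r_def field_simps)
  have bound: "norm (exp (- s * Ln (lam k))) \<le> C * norm (lam k) powr (- (Re s0 - r))"
    if "s \<in> ball s0 r" "k \<in> I" "norm (lam k) > 1" for s k
  proof -
    have *: "\<bar>Re s - Re s0\<bar> \<le> norm (s - s0)" "\<bar>Im s - Im s0\<bar> \<le> norm (s - s0)"
      using abs_Re_le_cmod[of "s - s0"] abs_Im_le_cmod[of "s - s0"] by simp_all
    have d: "norm (s - s0) < r" using that by (simp add: dist_norm norm_minus_commute)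
    have "norm (exp (- s * Ln (lam k))) \<le> norm (lam k) powr (- Re s) * exp (pi * \<bar>Im s\<bar>)"
      by (rule norm_exp_mult_Ln_le[OF nonzero[OF that(2)]])
    also have "\<dots> \<le> norm (lam k) powr (- (Re s0 - r)) * C"
      unfolding C_def using that * d by (intro mult_mono powr_mono) auto
    finally show ?thesis by (simp add: mult.commute)
  qed
  have hol: "(\<lambda>s. exp (- s * Ln (lam k))) holomorphic_on UNIV" for k
    by (intro holomorphic_intros)
  note E = infsum_entire[where f = "\<lambda>s k. exp (- s * Ln (lam k))", OF hol r \<sigma> bound]
  show "(\<lambda>k. exp (- s0 * Ln (lam k))) summable_on I" by (rule E(1))
  show "zeta_seq I lam field_differentiable (at s0)"
    using E(3) unfolding zeta_seq_def field_differentiable_def by blast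
qed

lemma zeta_seq_holomorphic: "zeta_seq I lam holomorphic_on {s. Re s > \<mu>}"
proof (rule holomorphic_onI)
  show "zeta_seq I lam field_differentiable (at s within {s. Re s > \<mu>})" if "s \<in> {s. Re s > \<mu>}" for s
    using zeta_seq_terms(2)[of s] that by (simp add: field_differentiable_at_within)
qed

end

section \<open>Poles of the continued zeta function\<close>

lemma eventually_exponent_less:
  assumes "filterlim e at_top sequentially"
  obtains N :: nat where "- e N < (b :: real)"
proof -
  from assms have "\<forall>\<^sub>F n in sequentially. e n > - b"
    unfolding filterlim_at_top_dense by blast
  then show ?thesis using that by (auto simp: eventually_sequentially) (metis minus_less_iff order_refl)
qed

text \<open>Once \<open>- e N < Re p\<close>, only summands with \<open>- e n = p\<close> are
  singular at \<open>p\<close>, each with a simple pole. The residue is multiplied by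
  \<open>rGamma p\<close>, and \<open>rGamma 0 = 0\<close> removes the pole at
  \<open>0\<close>.\<close>

lemma (in sequence_of_order) zeta_ext_simple_poles:
  assumes integrable: "\<And>s. Re s > \<mu> \<Longrightarrow>
          set_integrable lborel {0<..} (\<lambda>t. theta_seq I lam t * of_real t powr (s - 1))"
    and mellin: "\<And>s. Re s > \<mu> \<Longrightarrow>
          zeta_seq I lam s =
            1 / Gamma s * (LINT t:{0<..}|lborel. theta_seq I lam t * of_real t powr (s - 1))"
    and expansion: "asymp_expansion_at_0 (theta_seq I lam) c e"
    and exponents: "strict_mono e" "filterlim e at_top sequentially" "- e 0 = \<mu>"
  shows "mero_continuation \<mu> (zeta_seq I lam) UNIV (zeta_ext I lam \<mu>)"
    and "zeta_ext I lam \<mu> nicely_meromorphic_on UNIV"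
    and "\<exists>\<rho> h. h analytic_on {p} \<and> (\<forall>\<^sub>F s in at p. zeta_ext I lam \<mu> s = \<rho> / (s - p) + h s) \<and> (p = 0 \<longrightarrow> \<rho> = 0)"
proof -
  have "\<forall>N. \<exists>H. H holomorphic_on {s. Re s > - e N} \<and> (\<forall>s. Re s > \<mu> \<longrightarrow>
    (LINT t:{0<..}|lborel. theta_seq I lam t * of_real t powr (s - 1)) = (\<Sum>n\<le>N. c n / (s + of_real (e n))) + H s)"
    using mellin_expansion[OF integrable expansion exponents(1,3)] by blast
  from choice[OF this] obtain H where H: "\<And>N. H N holomorphic_on {s. Re s > - e N}"
    "\<And>N s. Re s > \<mu> \<Longrightarrow>
    (LINT t:{0<..}|lborel. theta_seq I lam t * of_real t powr (s - 1)) = (\<Sum>n\<le>N. c n / (s + of_real (e n))) + H N s"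
    by blast
  define F where "F = (\<lambda>N s. rGamma s * ((\<Sum>n\<le>N. c n / (s + of_real (e n))) + H N s))"
  have Han: "H N analytic_on {s. Re s > - e N}" for N
    using H(1) half_plane_Re_gt by (simp add: analytic_on_open)
  have F_mero: "F N meromorphic_on {s. Re s > - e N}" for N
    unfolding F_def
    by (intro meromorphic_intros analytic_on_imp_meromorphic_on[OF Han] analytic_on_imp_meromorphic_on[OF analytic_rGamma])
  have F_eq: "F N s = zeta_seq I lam s" if "Re s > \<mu>" for N s
    using mellin[OF that] H(2)[OF that, of N] by (simp add: F_def rGamma_inverse_Gamma field_simps)
  obtain G where G: "mero_continuation \<mu> (zeta_seq I lam) UNIV G" "G nicely_meromorphic_on UNIV"
  proof (rule meromorphic_continuation_glue[OF zeta_seq_holomorphic])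
    fix b
    obtain N where N: "- e N < b" using eventually_exponent_less[OF exponents(2)] .
    show "\<exists>F. F meromorphic_on {s. Re s > b} \<and> (\<forall>s. Re s > max \<mu> b \<longrightarrow> F s = zeta_seq I lam s)"
      by (rule exI[of _ "F N"]) (use N F_eq in \<open>auto intro!: meromorphic_on_subset[OF F_mero[of N]]\<close>)
  qed
  have ext: "zeta_ext I lam \<mu> = G" by (rule zeta_ext_eq[OF G])
  show "mero_continuation \<mu> (zeta_seq I lam) UNIV (zeta_ext I lam \<mu>)"
    "zeta_ext I lam \<mu> nicely_meromorphic_on UNIV" using G ext by auto
  obtain N where N: "- e N < Re p" using eventually_exponent_less[OF exponents(2)] .
  have mc: "mero_continuation \<mu> (zeta_seq I lam) {s. Re s > - e N} (F N)"
  proof -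
    have "- e N \<le> \<mu>" using exponents strict_mono_less_eq[OF exponents(1), of 0 N] by simp
    then show ?thesis unfolding mero_continuation_def using half_plane_Re_gt F_mero F_eq by auto
  qed
  have GF: "\<forall>\<^sub>F s in at p. F N s = G s"
    using mero_continuation_eq_at[OF mc G(1)] N by auto
  \<comment> \<open>\<open>P\<close> has at most one element, as \<open>e\<close> is strictly
    increasing; the set treats the presence and absence of a pole alike.\<close>
  define P where "P = {n. n \<le> N \<and> of_real (- e n) = p}"
  define \<kappa> where "\<kappa> = (\<Sum>n\<in>P. c n)"
  define q where "q = (\<lambda>s. (\<Sum>n\<in>{..N} - P. c n / (s + of_real (e n))) + H N s)"
  have q: "q analytic_on {p}"
    unfolding q_def
    by (intro analytic_intros analytic_on_subset[OF Han]) (use N in \<open>auto simp: P_def add_eq_0_iff2\<close>)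
  \<comment> \<open>Difference quotient of \<open>rGamma\<close> with its singularity removed:
    \<open>rGamma s / (s - p)\<close> equals \<open>rGamma p / (s - p) + g s\<close>.\<close>
  define g where "g = (\<lambda>s. if s = p then deriv rGamma p else (rGamma s - rGamma p) / (s - p))"
  have "g holomorphic_on UNIV" unfolding g_def by (rule pole_lemma) (auto intro: holomorphic_intros)
  then have g: "g analytic_on {p}" by (simp add: holomorphic_on_imp_analytic_at)
  have split: "F N s = (\<kappa> * rGamma p) / (s - p) + (rGamma s * q s + \<kappa> * g s)" if "s \<noteq> p" for s
  proof -
    have "(\<Sum>n\<le>N. c n / (s + of_real (e n))) =
        (\<Sum>n\<in>P. c n / (s + of_real (e n))) + (\<Sum>n\<in>{..N} - P. c n / (s + of_real (e n)))"
      by (subst sum.subset_diff[of P]) (auto simp: P_def)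
    also have "(\<Sum>n\<in>P. c n / (s + of_real (e n))) = (\<Sum>n\<in>P. c n / (s - p))"
      by (rule sum.cong) (auto simp: P_def)
    also have "\<dots> = \<kappa> / (s - p)" by (simp add: \<kappa>_def sum_divide_distrib)
    finally have "F N s = rGamma s * (\<kappa> / (s - p) + q s)" by (simp add: F_def q_def)
    then show ?thesis using that
      by (simp add: g_def distrib_left right_diff_distrib diff_divide_distrib mult.commute)
  qed
  have "\<forall>\<^sub>F s in at p. G s = (\<kappa> * rGamma p) / (s - p) + (rGamma s * q s + \<kappa> * g s)"
    using GF eventually_neq_at_within[of p p UNIV] by eventually_elim (use split in auto)
  moreover have "(\<lambda>s. rGamma s * q s + \<kappa> * g s) analytic_on {p}"
    by (intro analytic_intros q g)
  ultimately show "\<exists>\<rho> h. h analytic_on {p} \<and> (\<forall>\<^sub>F s in at p. zeta_ext I lam \<mu> s = \<rho> / (s - p) + h s) \<and> (p = 0 \<longrightarrow> \<rho> = 0)"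
    unfolding ext by (intro exI[of _ "\<kappa> * rGamma p"] exI[of _ "\<lambda>s. rGamma s * q s + \<kappa> * g s"]) auto
qed

section \<open>Taylor coefficients of the shifted factors\<close>

text \<open>Cauchy's estimate bounds the coefficients by \<open>B / \<rho> ^ p\<close>, so the tail
  is dominated by a geometric series of ratio at most \<open>1/2\<close>, whence the factor
  \<open>2\<close>. The constant involves \<open>f\<close> only through \<open>B\<close>, which
  later makes the bound uniform in \<open>s\<close>.\<close>

lemma taylor_remainder_bound:
  fixes f :: "complex \<Rightarrow> complex"
  assumes hol: "f holomorphic_on ball 0 R" and F: "f has_fps_expansion F" and \<rho>: "0 < \<rho>" "\<rho> < R"
    and B: "\<And>w. norm w \<le> \<rho> \<Longrightarrow> norm (f w) \<le> B" and w: "norm w \<le> \<rho> / 2"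
  shows "norm (f w - (\<Sum>p\<le>P. fps_nth F p * w ^ p)) \<le> 2 * B * (norm w / \<rho>) ^ Suc P"
proof -
  have B0: "B \<ge> 0" using B[of 0] \<rho> norm_ge_zero[of "f 0"] by (simp del: norm_ge_zero)
  define x where "x = norm w / \<rho>"
  have x: "x \<ge> 0" "x \<le> 1/2" using w \<rho> by (auto simp: x_def field_simps)
  have coeff: "norm (fps_nth F p) \<le> B / \<rho> ^ p" for p
  proof -
    have "norm ((deriv ^^ p) f 0) \<le> fact p * B / \<rho> ^ p"
    proof (rule Cauchy_inequality)
      show "f holomorphic_on ball 0 \<rho>" by (rule holomorphic_on_subset[OF hol]) (use \<rho> in auto)
      show "continuous_on (cball 0 \<rho>) f"
        by (rule continuous_on_subset[OF holomorphic_on_imp_continuous_on[OF hol]]) (use \<rho> in auto)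
    qed (use B \<rho> in auto)
    then have "norm ((deriv ^^ p) f 0) / fact p \<le> (fact p * B / \<rho> ^ p) / fact p" by (intro divide_right_mono) auto
    then show ?thesis by (simp add: fps_nth_fps_expansion[OF F, of p] norm_divide)
  qed
  have "w \<in> ball 0 R" using w \<rho> by simp
  from holomorphic_power_series[OF hol this]
  have sm: "(\<lambda>p. fps_nth F p * w ^ p) sums f w" by (simp add: fps_nth_fps_expansion[OF F])
  have "(\<lambda>p. fps_nth F (p + Suc P) * w ^ (p + Suc P)) sums (f w - (\<Sum>p<Suc P. fps_nth F p * w ^ p))"
    using sums_split_initial_segment[OF sm, of "Suc P"] .
  then have tail: "(\<lambda>p. fps_nth F (p + Suc P) * w ^ (p + Suc P)) sums (f w - (\<Sum>p\<le>P. fps_nth F p * w ^ p))"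
    by (simp only: lessThan_Suc_atMost)
  have term_le: "norm (fps_nth F p * w ^ p) \<le> B * x ^ p" for p
    using mult_right_mono[OF coeff[of p], of "norm w ^ p"]
    by (simp add: norm_mult norm_power x_def power_divide)
  have geo: "(\<lambda>p. B * x ^ Suc P * x ^ p) sums (B * x ^ Suc P * (1 / (1 - x)))"
    using x by (intro sums_mult geometric_sums) auto
  have "norm (f w - (\<Sum>p\<le>P. fps_nth F p * w ^ p)) \<le> B * x ^ Suc P * (1 / (1 - x))"
  proof -
    have "norm (\<Sum>p. fps_nth F (p + Suc P) * w ^ (p + Suc P)) \<le> (\<Sum>p. B * x ^ Suc P * x ^ p)"
    proof (rule norm_suminf_le)
      show "norm (fps_nth F (p + Suc P) * w ^ (p + Suc P)) \<le> B * x ^ Suc P * x ^ p" for p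
        using term_le[of "p + Suc P"] by (simp add: power_add mult_ac)
    qed (use geo in \<open>auto simp: sums_iff\<close>)
    then show ?thesis using tail geo by (simp only: sums_iff)
  qed
  also have "\<dots> \<le> B * x ^ Suc P * 2"
    using x B0 by (intro mult_left_mono) (auto simp: field_simps)
  finally show ?thesis by (simp add: x_def mult_ac)
qed

text \<open>
  With \<open>Q = log_sum J z\<close> one has \<open>\<Prod>j\<in>J. (1 - z j * w) powr (- s) = exp (s * Q w)\<close>;
  \<open>taylor_coeff J z p s\<close> is the coefficient of \<open>w ^ p\<close>. For \<open>p > 0\<close> it is divisible by \<open>s\<close>,
  with quotient \<open>taylor_quot J z p s\<close>, and this zero at \<open>s = 0\<close> cancels the pole of the zeta function.
\<close>

definition log_sum :: "'j set \<Rightarrow> ('j \<Rightarrow> complex) \<Rightarrow> complex \<Rightarrow> complex" where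
  "log_sum J z w = - (\<Sum>j\<in>J. Ln (1 - z j * w))"

(* The constant coefficient is the junk value x / 0 = 0, which is the right one. *)
definition log_sum_fps :: "'j set \<Rightarrow> ('j \<Rightarrow> complex) \<Rightarrow> complex fps" where
  "log_sum_fps J z = Abs_fps (\<lambda>l. (\<Sum>j\<in>J. z j ^ l) / of_nat l)"

definition taylor_coeff :: "'j set \<Rightarrow> ('j \<Rightarrow> complex) \<Rightarrow> nat \<Rightarrow> complex \<Rightarrow> complex" where
  "taylor_coeff J z p s = fps_nth (fps_compose (fps_exp s) (log_sum_fps J z)) p"

definition taylor_quot :: "'j set \<Rightarrow> ('j \<Rightarrow> complex) \<Rightarrow> nat \<Rightarrow> complex \<Rightarrow> complex" where
  "taylor_quot J z p s = (\<Sum>i<p. s ^ i / fact (Suc i) * fps_nth (log_sum_fps J z ^ Suc i) p)"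

text \<open>This radius keeps every \<open>1 - z j * w\<close> away from the branch cut of the
  logarithm; the summand \<open>1\<close> avoids a zero denominator when all \<open>z j\<close>
  vanish.\<close>

lemma norm_mult_lt_1:
  assumes "finite J" "j \<in> J" "norm w < 1 / (1 + (\<Sum>j\<in>J. norm (z j)))"
  shows "norm (z j * w :: complex) < 1"
proof -
  have "norm (z j) \<le> (\<Sum>j\<in>J. norm (z j))" using assms by (intro member_le_sum) auto
  moreover have S: "(\<Sum>j\<in>J. norm (z j)) \<ge> 0" by (intro sum_nonneg) auto
  ultimately have "norm (z j) * norm w \<le> (1 + (\<Sum>j\<in>J. norm (z j))) * norm w"
    by (intro mult_right_mono) auto
  also have "\<dots> < 1" using assms(3) S by (simp add: field_simps)
  finally show ?thesis by (simp add: norm_mult)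
qed

lemma log_sum_holomorphic:
  assumes "finite J"
  shows "log_sum J z holomorphic_on ball 0 (1 / (1 + (\<Sum>j\<in>J. norm (z j))))"
  unfolding log_sum_def
proof (intro holomorphic_intros)
  fix j and w :: complex assume jw: "j \<in> J" "w \<in> ball 0 (1 / (1 + (\<Sum>j\<in>J. norm (z j))))"
  then have "norm (z j * w) < 1" by (intro norm_mult_lt_1[OF assms]) auto
  then have "Re (z j * w) < 1" using complex_Re_le_cmod[of "z j * w"] by linarith
  then show "1 - z j * w \<notin> \<real>\<^sub>\<le>\<^sub>0" by (simp add: complex_nonpos_Reals_iff)
qed

lemma log_sum_has_fps_expansion:
  assumes "finite J"
  shows "log_sum J z has_fps_expansion log_sum_fps J z"
proof (rule has_fps_expansionI)
  have S: "(\<Sum>j\<in>J. norm (z j)) \<ge> 0" by (intro sum_nonneg) auto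
  have "\<forall>\<^sub>F u in nhds 0. u \<in> ball 0 (1 / (1 + (\<Sum>j\<in>J. norm (z j))))"
    using S by (intro eventually_nhds_in_open) auto
  then show "\<forall>\<^sub>F u in nhds 0. (\<lambda>n. fps_nth (log_sum_fps J z) n * u ^ n) sums log_sum J z u"
  proof eventually_elim
    fix u :: complex assume u: "u \<in> ball 0 (1 / (1 + (\<Sum>j\<in>J. norm (z j))))"
    have "(\<lambda>n. - ((z j * u) ^ n / of_nat n)) sums Ln (1 - z j * u)" if "j \<in> J" for j
      using Ln_series'[of "- (z j * u)"] norm_mult_lt_1[OF assms that, of u z] u by simp
    from sums_minus[OF sums_sum[OF this]]
    show "(\<lambda>n. fps_nth (log_sum_fps J z) n * u ^ n) sums log_sum J z u"
      by (simp add: log_sum_def log_sum_fps_def sum_negf sum_divide_distrib sum_distrib_right power_mult_distrib)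
  qed
qed

lemma exp_log_sum_has_fps_expansion:
  assumes "finite J"
  shows "(\<lambda>w. exp (s * log_sum J z w)) has_fps_expansion fps_compose (fps_exp s) (log_sum_fps J z)"
proof -
  have "((\<lambda>x. exp (s * x)) \<circ> log_sum J z) has_fps_expansion fps_compose (fps_exp s) (log_sum_fps J z)"
    by (intro has_fps_expansion_compose has_fps_expansion_exp log_sum_has_fps_expansion[OF assms])
       (simp add: log_sum_fps_def)
  then show ?thesis by (simp add: o_def)
qed

lemma log_sum_bounded:
  assumes "finite J"
  obtains B where "\<And>w. norm w \<le> 1 / (2 * (1 + (\<Sum>j\<in>J. norm (z j)))) \<Longrightarrow> norm (log_sum J z w) \<le> B"
proof -
  have S: "(\<Sum>j\<in>J. norm (z j)) \<ge> 0" by (intro sum_nonneg) auto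
  define R where "R = 1 / (1 + (\<Sum>j\<in>J. norm (z j)))"
  have R: "R > 0" "1 / (2 * (1 + (\<Sum>j\<in>J. norm (z j)))) = R / 2" using S by (auto simp: R_def)
  have "continuous_on (cball 0 (R / 2)) (log_sum J z)"
    by (rule continuous_on_subset[OF holomorphic_on_imp_continuous_on[OF log_sum_holomorphic[OF assms]]])
       (use R(1) in \<open>auto simp: R_def[symmetric]\<close>)
  then have "bounded (log_sum J z ` cball 0 (R / 2))"
    by (intro compact_imp_bounded compact_continuous_image) auto
  then obtain B where "\<forall>w\<in>cball 0 (R/2). norm (log_sum J z w) \<le> B"
    unfolding bounded_iff by blast
  then show ?thesis using that[of B] unfolding R(2) by simp
qed

section \<open>Dependence of the coefficients on \<open>s\<close> near zero\<close>

lemma taylor_coeff_0 [simp]: "taylor_coeff J z 0 s = 1"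
  by (simp add: taylor_coeff_def)

text \<open>The series \<open>log_sum_fps J z\<close> has no constant term, so in the exponential
  series only the powers \<open>i \<le> p\<close> reach \<open>w ^ p\<close>, and
  \<open>i = 0\<close> does not for \<open>p > 0\<close>. What remains is a polynomial in
  \<open>s\<close> without constant term.\<close>

lemma taylor_coeff_eq_quot:
  assumes "p > 0"
  shows "taylor_coeff J z p s = s * taylor_quot J z p s"
proof -
  have "taylor_coeff J z p s = (\<Sum>i=0..p. s ^ i / fact i * fps_nth (log_sum_fps J z ^ i) p)"
    by (simp add: taylor_coeff_def fps_compose_nth)
  also have "\<dots> = (\<Sum>i\<in>{Suc 0..p}. s ^ i / fact i * fps_nth (log_sum_fps J z ^ i) p)"
    using assms by (subst sum.atLeast_Suc_atMost) auto
  also have "{Suc 0..p} = Suc ` {..<p}"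
    by (simp add: lessThan_atLeast0 atLeastLessThanSuc_atLeastAtMost)
  also have "(\<Sum>i\<in>Suc ` {..<p}. s ^ i / fact i * fps_nth (log_sum_fps J z ^ i) p) = s * taylor_quot J z p s"
    by (simp add: sum.reindex taylor_quot_def sum_distrib_left mult_ac del: fact_Suc power_Suc) (simp add: mult_ac)
  finally show ?thesis .
qed

lemma taylor_coeff_holomorphic: "taylor_coeff J z p holomorphic_on A"
proof (cases "p = 0")
  case True
  then have "taylor_coeff J z p = (\<lambda>s. 1)" by auto
  then show ?thesis by simp
next
  case False
  then have "taylor_coeff J z p = (\<lambda>s. s * taylor_quot J z p s)" using taylor_coeff_eq_quot[of p] by blast
  then show ?thesis by (auto simp: taylor_quot_def intro!: holomorphic_intros)
qed

lemma taylor_quot_0: "p > 0 \<Longrightarrow> taylor_quot J z p 0 = (\<Sum>j\<in>J. z j ^ p) / of_nat p"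
proof -
  assume p: "p > 0"
  have "taylor_quot J z p 0 = (\<Sum>i<p. if i = 0 then fps_nth (log_sum_fps J z) p else 0)"
    unfolding taylor_quot_def by (intro sum.cong) auto
  then show ?thesis using p by (simp add: log_sum_fps_def)
qed

lemma taylor_quot_deriv_0:
  "(taylor_quot J z p has_field_derivative fps_nth (log_sum_fps J z ^ 2) p / 2) (at 0)"
proof -
  have "(taylor_quot J z p has_field_derivative
      (\<Sum>i<p. of_nat i * 0 ^ (i - 1) / fact (Suc i) * fps_nth (log_sum_fps J z ^ Suc i) p)) (at 0)"
    unfolding taylor_quot_def
    by (rule derivative_eq_intros refl | simp del: fact_Suc power_Suc)+
  also have "(\<Sum>i<p. of_nat i * 0 ^ (i - 1) / fact (Suc i) * fps_nth (log_sum_fps J z ^ Suc i) p) =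
      (\<Sum>i<p. if i = 1 then fps_nth (log_sum_fps J z ^ 2) p / 2 else 0)"
  proof (rule sum.cong)
    show "of_nat i * 0 ^ (i - 1) / fact (Suc i) * fps_nth (log_sum_fps J z ^ Suc i) p =
        (if i = 1 then fps_nth (log_sum_fps J z ^ 2) p / 2 else 0)" for i
      by (cases "i = 0"; cases "i = 1") (auto simp: numeral_2_eq_2)
  qed simp
  also have "\<dots> = fps_nth (log_sum_fps J z ^ 2) p / 2"
  \<comment> \<open>For \<open>p \<le> 1\<close> the index \<open>1\<close> lies outside the range,
    but the square of a series without constant term has no coefficient there either.\<close>
  proof (cases "p > 1")
    case False
    then have "p = 0 \<or> p = 1" by auto
    then have "fps_nth (log_sum_fps J z ^ 2) p = 0"
      by (auto simp: power2_eq_square fps_mult_nth log_sum_fps_def)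
    then show ?thesis by simp
  qed simp
  finally show ?thesis .
qed

section \<open>The zeta function of the shifted sequence\<close>

lemma has_sum_finite_sum:
  fixes f :: "'b \<Rightarrow> 'a \<Rightarrow> 'c :: topological_comm_monoid_add"
  assumes "finite S" "\<And>p. p \<in> S \<Longrightarrow> (f p has_sum g p) A"
  shows "((\<lambda>k. \<Sum>p\<in>S. f p k) has_sum (\<Sum>p\<in>S. g p)) A"
  using assms by (induction S rule: finite_induct) (auto intro: has_sum_add)

locale shifted_sequence = sequence_of_order I lam \<mu>
  for I :: "'i set" and lam :: "'i \<Rightarrow> complex" and \<mu> :: real +
  fixes J :: "'j set" and z :: "'j \<Rightarrow> complex" and L :: "'j \<Rightarrow> 'i \<Rightarrow> complex"
  assumes finite_J: "finite J" and J_nonempty: "J \<noteq> {}"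
    and branch: "\<And>j. j \<in> J \<Longrightarrow> log_branch I lam (z j) (L j)"
begin

text \<open>
  The terms with \<open>p \<le> P\<close> sum over \<open>k\<close> to values of the zeta function of \<open>lam\<close>. What is left is
  \<open>O(norm (lam k) powr (- card J * Re s - P - 1))\<close>, and it is entire in \<open>s\<close> for every \<open>k\<close>, so that
  the finitely many arbitrary branches need no separate treatment.
\<close>

definition remainder :: "nat \<Rightarrow> complex \<Rightarrow> 'i \<Rightarrow> complex" where
  "remainder P s k = exp (- s * (\<Sum>j\<in>J. L j k)) -
     (\<Sum>p\<le>P. taylor_coeff J z p s * exp (- (of_nat (card J) * s + of_nat p) * Ln (lam k)))"

lemma card_J: "real (card J) > 0"
  using finite_J J_nonempty by (simp add: card_gt_0_iff)

lemma remainder_holomorphic: "(\<lambda>s. remainder P s k) holomorphic_on A"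
  unfolding remainder_def by (intro holomorphic_intros taylor_coeff_holomorphic)

text \<open>Beyond this radius \<open>norm (lam k) > norm (z j)\<close> for every \<open>j\<close>,
  so the logarithms are the prescribed ones and the summand factors through
  \<open>w = 1 / lam k\<close>; the bracket is a Taylor remainder in \<open>w\<close>.\<close>

lemma remainder_eq:
  assumes k: "k \<in> I" and big: "norm (lam k) > 1 + (\<Sum>j\<in>J. norm (z j))"
  shows "remainder P s k = exp (- (of_nat (card J) * s) * Ln (lam k)) *
    (exp (s * log_sum J z (1 / lam k)) - (\<Sum>p\<le>P. taylor_coeff J z p s * (1 / lam k) ^ p))"
proof -
  have "L j k = Ln (lam k) + Ln (1 - z j / lam k)" if j: "j \<in> J" for j
  proof -
    have "norm (z j) \<le> (\<Sum>j\<in>J. norm (z j))" using finite_J j by (intro member_le_sum) auto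
    then show ?thesis using branch[OF j] big k by (auto simp: log_branch_def)
  qed
  then have A: "(\<Sum>j\<in>J. L j k) = of_nat (card J) * Ln (lam k) - log_sum J z (1 / lam k)"
    by (simp add: log_sum_def sum.distrib)
  have "exp (- (of_nat (card J) * s + of_nat p) * Ln (lam k)) =
      exp (- (of_nat (card J) * s) * Ln (lam k)) * (1 / lam k) ^ p" for p
  proof -
    have "exp (- (of_nat (card J) * s + of_nat p) * Ln (lam k)) =
      exp (- (of_nat (card J) * s) * Ln (lam k)) * exp (of_nat p * - Ln (lam k))"
      by (simp add: exp_add[symmetric] algebra_simps)
    also have "exp (of_nat p * - Ln (lam k)) = (1 / lam k) ^ p"
      using nonzero[OF k] by (subst exp_of_nat_mult) (simp add: exp_minus inverse_eq_divide)
    finally show ?thesis .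
  qed
  moreover have "exp (- s * (\<Sum>j\<in>J. L j k)) =
      exp (- (of_nat (card J) * s) * Ln (lam k)) * exp (s * log_sum J z (1 / lam k))"
    unfolding A by (simp add: exp_add[symmetric] algebra_simps)
  ultimately show ?thesis
    unfolding remainder_def by (simp add: right_diff_distrib sum_distrib_left mult_ac)
qed

lemma remainder_bound:
  assumes s0: "real (card J) * Re s0 + real P + 1 > \<mu>"
  obtains r \<sigma> R C where "r > 0" "\<sigma> > \<mu>"
    "\<And>s k. s \<in> ball s0 r \<Longrightarrow> k \<in> I \<Longrightarrow> norm (lam k) > R \<Longrightarrow>
      norm (remainder P s k) \<le> C * norm (lam k) powr (- \<sigma>)"
proof -
  define Z where "Z = 1 + (\<Sum>j\<in>J. norm (z j))"
  have Z: "Z \<ge> 1" unfolding Z_def by (simp add: sum_nonneg)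
  \<comment> \<open>Half of the radius \<open>1 / Z\<close> on which \<open>log_sum\<close> is
    holomorphic. Together with \<open>norm (lam k) > 4 * Z\<close> this gives
    \<open>norm w \<le> \<rho> / 2\<close>, as \<open>taylor_remainder_bound\<close>
    requires.\<close>
  define \<rho> where "\<rho> = 1 / (2 * Z)"
  obtain B where B: "\<And>w. norm w \<le> \<rho> \<Longrightarrow> norm (log_sum J z w) \<le> B"
    using log_sum_bounded[OF finite_J, of z] unfolding \<rho>_def Z_def by blast
  define n where "n = real (card J)"
  have n: "n > 0" using card_J by (simp add: n_def)
  \<comment> \<open>Chosen so that \<open>2 * n * r\<close> is the excess of
    \<open>n * Re s0 + P + 1\<close> over \<open>\<mu>\<close>. Moving \<open>s\<close> inside the
    ball costs at most \<open>n * r\<close>, which leaves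
    \<open>\<sigma> = \<mu> + n * r\<close>.\<close>
  define r where "r = (n * Re s0 + real P + 1 - \<mu>) / (2 * n)"
  define \<sigma> where "\<sigma> = n * Re s0 - n * r + real P + 1"
  have r: "r > 0" using s0 n by (simp add: r_def n_def)
  have nr: "2 * (n * r) = n * Re s0 + real P + 1 - \<mu>" using n by (simp add: r_def)
  have \<sigma>: "\<sigma> > \<mu>" using nr s0 unfolding \<sigma>_def n_def by linarith
  \<comment> \<open>\<open>M\<close> bounds \<open>norm s\<close> on the ball. In \<open>C\<close>
    the first factor comes from the argument of \<open>lam k\<close>, the second from the Taylor
    remainder.\<close>
  define M where "M = norm s0 + r"
  define C where "C = exp (pi * (n * M)) * (2 * exp (M * B) * (1 / \<rho>) ^ Suc P)"
  have \<rho>: "\<rho> > 0" "\<rho> < 1 / Z" using Z by (auto simp: \<rho>_def field_simps)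
  have main: "norm (remainder P s k) \<le> C * norm (lam k) powr (- \<sigma>)"
    if s: "s \<in> ball s0 r" and k: "k \<in> I" and big: "norm (lam k) > 4 * Z" for s k
  proof -
    have lk: "norm (lam k) > 1" "norm (lam k) > Z" using big Z by auto
    define w where "w = 1 / lam k"
    have nw: "norm w = 1 / norm (lam k)" by (simp add: w_def norm_divide)
    have "1 / norm (lam k) \<le> 1 / (4 * Z)" using big Z by (intro frac_le) auto
    then have w: "norm w \<le> \<rho> / 2" by (simp add: nw \<rho>_def)
    have d: "norm (s - s0) < r" using s by (simp add: dist_norm norm_minus_commute)
    have sM: "norm s \<le> M" using norm_triangle_ineq[of s0 "s - s0"] d by (simp add: M_def)
    have hol: "(\<lambda>w. exp (s * log_sum J z w)) holomorphic_on ball 0 (1 / Z)"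
      unfolding Z_def by (intro holomorphic_intros log_sum_holomorphic finite_J)
    have "norm (exp (s * log_sum J z v)) \<le> exp (M * B)" if "norm v \<le> \<rho>" for v
    proof -
      have "norm (exp (s * log_sum J z v)) \<le> exp (norm (s * log_sum J z v))"
        by (rule norm_exp)
      also have "\<dots> \<le> exp (M * B)"
        using mult_mono[OF sM B[OF that] order.trans[OF norm_ge_zero sM] norm_ge_zero]
        by (simp add: norm_mult)
      finally show ?thesis .
    qed
    then have tay: "norm (exp (s * log_sum J z w) - (\<Sum>p\<le>P. fps_nth (fps_compose (fps_exp s) (log_sum_fps J z)) p * w ^ p))
        \<le> 2 * exp (M * B) * (norm w / \<rho>) ^ Suc P"
      using taylor_remainder_bound[OF hol exp_log_sum_has_fps_expansion[OF finite_J] \<rho> _ w] by blast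
    have "norm (exp (- (of_nat (card J) * s) * Ln (lam k))) \<le>
        norm (lam k) powr (- (n * Re s)) * exp (pi * \<bar>n * Im s\<bar>)"
      using norm_exp_mult_Ln_le[OF nonzero[OF k], of "of_nat (card J) * s"] by (simp add: n_def)
    also have "\<dots> \<le> norm (lam k) powr (- (n * Re s)) * exp (pi * (n * M))"
      using order.trans[OF abs_Im_le_cmod sM] n by (intro mult_left_mono) (auto simp: abs_mult)
    finally have e1: "norm (exp (- (of_nat (card J) * s) * Ln (lam k))) \<le>
        norm (lam k) powr (- (n * Re s)) * exp (pi * (n * M))" .
    have "norm (remainder P s k) \<le> (norm (lam k) powr (- (n * Re s)) * exp (pi * (n * M))) *
        (2 * exp (M * B) * (norm w / \<rho>) ^ Suc P)"
      using remainder_eq[OF k, of P s] lk e1 tay unfolding Z_def taylor_coeff_def w_def[symmetric]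
      by (simp only: norm_mult) (intro mult_mono, auto)
    also have "(norm w / \<rho>) ^ Suc P = (1 / \<rho>) ^ Suc P * norm (lam k) powr (- real (Suc P))"
      using lk nonzero[OF k] powr_realpow[of "norm (lam k)" "Suc P"]
      by (simp add: nw power_divide powr_minus field_simps del: power_Suc of_nat_Suc)
    also have "(norm (lam k) powr (- (n * Re s)) * exp (pi * (n * M))) *
        (2 * exp (M * B) * ((1 / \<rho>) ^ Suc P * norm (lam k) powr (- real (Suc P)))) =
      C * norm (lam k) powr (- (n * Re s) - real (Suc P))"
      unfolding C_def diff_conv_add_uminus powr_add by (simp only: mult_ac)
    also have "\<dots> \<le> C * norm (lam k) powr (- \<sigma>)"
    proof -
      have "Re s0 - Re s \<le> norm (s - s0)" using abs_Re_le_cmod[of "s - s0"] by auto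
      then have "n * (Re s0 - Re s) \<le> n * r" using d n by (intro mult_left_mono) auto
      then have "- (n * Re s) - real (Suc P) \<le> - \<sigma>" by (simp add: \<sigma>_def algebra_simps)
      then show ?thesis using lk \<rho> by (intro mult_left_mono powr_mono) (auto simp: C_def)
    qed
    finally show ?thesis .
  qed
  show ?thesis by (rule that[OF r \<sigma>, of "4 * Z" C]) (use main in auto)
qed

lemma remainder_infsum:
  assumes s0: "real (card J) * Re s0 + real P + 1 > \<mu>"
  shows "remainder P s0 summable_on I"
    and "(\<lambda>k. deriv (\<lambda>s. remainder P s k) s0) summable_on I"
    and "((\<lambda>s. \<Sum>\<^sub>\<infinity>k\<in>I. remainder P s k) has_field_derivative
          (\<Sum>\<^sub>\<infinity>k\<in>I. deriv (\<lambda>s. remainder P s k) s0)) (at s0)"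
proof -
  obtain r \<sigma> R C where B: "r > 0" "\<sigma> > \<mu>"
    "\<And>s k. s \<in> ball s0 r \<Longrightarrow> k \<in> I \<Longrightarrow> norm (lam k) > R \<Longrightarrow>
      norm (remainder P s k) \<le> C * norm (lam k) powr (- \<sigma>)"
    using remainder_bound[OF s0] by blast
  note E = infsum_entire[where f = "remainder P", OF remainder_holomorphic B]
  show "remainder P s0 summable_on I"
    and "(\<lambda>k. deriv (\<lambda>s. remainder P s k) s0) summable_on I"
    and "((\<lambda>s. \<Sum>\<^sub>\<infinity>k\<in>I. remainder P s k) has_field_derivative
          (\<Sum>\<^sub>\<infinity>k\<in>I. deriv (\<lambda>s. remainder P s k) s0)) (at s0)"
    using E by blast+
qed

lemma remainder_sum_holomorphic:
  "(\<lambda>s. \<Sum>\<^sub>\<infinity>k\<in>I. remainder P s k) holomorphic_on {s. Re s > (\<mu> - real P - 1) / real (card J)}"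
proof (rule holomorphic_onI)
  fix s assume "s \<in> {s. Re s > (\<mu> - real P - 1) / real (card J)}"
  then have "real (card J) * Re s + real P + 1 > \<mu>" using card_J by (simp add: field_simps)
  from remainder_infsum(3)[OF this]
  show "(\<lambda>s. \<Sum>\<^sub>\<infinity>k\<in>I. remainder P s k) field_differentiable
      (at s within {s. Re s > (\<mu> - real P - 1) / real (card J)})"
    using field_differentiable_at_within field_differentiable_def by blast
qed

text \<open>For these \<open>s\<close> every \<open>n * s + p\<close> with \<open>n = card J\<close>
  lies in the half-plane of convergence, so each piece may be summed separately, for any
  \<open>P\<close>.\<close>

lemma shifted_zeta_eq:
  assumes s: "Re s > \<mu> / real (card J)"
  shows "shifted_zeta I J L s = (\<Sum>p\<le>P. taylor_coeff J z p s * zeta_seq I lam (of_nat (card J) * s + of_nat p))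
      + (\<Sum>\<^sub>\<infinity>k\<in>I. remainder P s k)"
proof -
  have ns: "real (card J) * Re s > \<mu>" using s card_J by (simp add: field_simps)
  have zs: "(\<lambda>k. exp (- (of_nat (card J) * s + of_nat p) * Ln (lam k))) summable_on I" for p
    by (rule zeta_seq_terms(1)) (use ns in simp)
  have rs: "remainder P s summable_on I" by (rule remainder_infsum(1)) (use ns in simp)
  have "((\<lambda>k. taylor_coeff J z p s * exp (- (of_nat (card J) * s + of_nat p) * Ln (lam k))) has_sum
      taylor_coeff J z p s * zeta_seq I lam (of_nat (card J) * s + of_nat p)) I" for p
    unfolding zeta_seq_def by (intro has_sum_cmult_right has_sum_infsum zs)
  then have "((\<lambda>k. (\<Sum>p\<le>P. taylor_coeff J z p s * exp (- (of_nat (card J) * s + of_nat p) * Ln (lam k)))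
        + remainder P s k) has_sum
      (\<Sum>p\<le>P. taylor_coeff J z p s * zeta_seq I lam (of_nat (card J) * s + of_nat p))
      + (\<Sum>\<^sub>\<infinity>k\<in>I. remainder P s k)) I"
    by (intro has_sum_add has_sum_finite_sum has_sum_infsum rs) auto
  moreover have "(\<Sum>p\<le>P. taylor_coeff J z p s * exp (- (of_nat (card J) * s + of_nat p) * Ln (lam k)))
        + remainder P s k = exp (- s * (\<Sum>j\<in>J. L j k))" for k
    by (simp add: remainder_def)
  ultimately have "((\<lambda>k. exp (- s * (\<Sum>j\<in>J. L j k))) has_sum
      (\<Sum>p\<le>P. taylor_coeff J z p s * zeta_seq I lam (of_nat (card J) * s + of_nat p))
      + (\<Sum>\<^sub>\<infinity>k\<in>I. remainder P s k)) I"
    by (simp only:)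
  then show ?thesis
    unfolding shifted_zeta_def by (simp add: exp_sum[OF finite_J, symmetric] sum_distrib_left sum_negf infsumI)
qed

lemma shifted_zeta_holomorphic: "shifted_zeta I J L holomorphic_on {s. Re s > \<mu> / real (card J)}"
proof -
  \<comment> \<open>Already \<open>P = 0\<close> makes the remainder sum holomorphic for
    \<open>Re s > (\<mu> - 1) / card J\<close>, a larger half-plane.\<close>
  have "(\<lambda>s. (\<Sum>p\<le>0. taylor_coeff J z p s * zeta_seq I lam (of_nat (card J) * s + of_nat p))
      + (\<Sum>\<^sub>\<infinity>k\<in>I. remainder 0 s k)) holomorphic_on {s. Re s > \<mu> / real (card J)}"
  proof (intro holomorphic_intros taylor_coeff_holomorphic)
    show "(\<lambda>s. \<Sum>\<^sub>\<infinity>k\<in>I. remainder 0 s k) holomorphic_on {s. Re s > \<mu> / real (card J)}"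
      by (rule holomorphic_on_subset[OF remainder_sum_holomorphic])
         (use card_J in \<open>auto simp: field_simps\<close>)
    show "(\<lambda>s. zeta_seq I lam (of_nat (card J) * s + of_nat p)) holomorphic_on {s. Re s > \<mu> / real (card J)}" for p
      by (rule holomorphic_on_compose_gen[OF _ zeta_seq_holomorphic, unfolded o_def])
         (use card_J in \<open>auto intro!: holomorphic_intros simp: field_simps add_strict_increasing\<close>)
  qed
  then show ?thesis
    by (rule holomorphic_transform) (use shifted_zeta_eq[of _ 0] in auto)
qed

text \<open>The negative derivative at \<open>0\<close> is the sum over \<open>j\<close> of
  \<open>L j k - Ln (lam k)\<close> plus the first \<open>m\<close> terms of the logarithm series.
  Since \<open>exp (L j k) = lam k - z j\<close> for every admissible branch, the identity holds for
  all \<open>k\<close>, including the small ones.\<close>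

lemma exp_remainder_deriv_0:
  assumes k: "k \<in> I"
  shows "exp (- deriv (\<lambda>s. remainder m s k) 0) =
    (\<Prod>j\<in>J. (1 - z j / lam k) * exp (\<Sum>l=1..m. z j ^ l / (of_nat l * lam k ^ l)))"
proof -
  define n where "n = (of_nat (card J) :: complex)"
  define A where "A = (\<Sum>j\<in>J. L j k)"
  have pw: "exp (- (n * 0 + of_nat p) * Ln (lam k)) = 1 / lam k ^ p" for p
  proof -
    have "exp (- (n * 0 + of_nat p) * Ln (lam k)) = exp (of_nat p * - Ln (lam k))" by simp
    also have "\<dots> = 1 / lam k ^ p"
      using nonzero[OF k] by (subst exp_of_nat_mult) (simp add: exp_minus inverse_eq_divide power_divide)
    finally show ?thesis .
  qed
  have split: "{..m} = insert 0 {1..m}" by auto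
  have rem: "remainder m s k = exp (- s * A) - (exp (- (n * s) * Ln (lam k)) +
      (\<Sum>p\<in>{1..m}. (s * taylor_quot J z p s) * exp (- (n * s + of_nat p) * Ln (lam k))))" for s
    unfolding remainder_def split A_def n_def by (simp add: taylor_coeff_eq_quot)
  \<comment> \<open>The factor \<open>s\<close> vanishes at \<open>0\<close>, so the product rule
    leaves only the value of the other factors there.\<close>
  have t: "((\<lambda>s. (s * taylor_quot J z p s) * exp (- (n * s + of_nat p) * Ln (lam k))) has_field_derivative
      (\<Sum>j\<in>J. z j ^ p) / of_nat p * (1 / lam k ^ p)) (at 0)" if "p \<in> {1..m}" for p
  proof -
    have "((\<lambda>s. (s * taylor_quot J z p s) * exp (- (n * s + of_nat p) * Ln (lam k))) has_field_derivative
      taylor_quot J z p 0 * exp (- (n * 0 + of_nat p) * Ln (lam k))) (at 0)"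
      by (rule derivative_eq_intros taylor_quot_deriv_0 refl | simp)+
    then show ?thesis using that by (simp only: pw) (simp add: taylor_quot_0)
  qed
  have d1: "((\<lambda>s. exp (- s * A)) has_field_derivative - A) (at 0)"
    by (auto intro!: derivative_eq_intros)
  have d2: "((\<lambda>s. exp (- (n * s) * Ln (lam k))) has_field_derivative - n * Ln (lam k)) (at 0)"
    by (auto intro!: derivative_eq_intros)
  have "((\<lambda>s. remainder m s k) has_field_derivative
      (- A - (- n * Ln (lam k) + (\<Sum>p\<in>{1..m}. (\<Sum>j\<in>J. z j ^ p) / of_nat p * (1 / lam k ^ p))))) (at 0)"
    unfolding rem by (intro DERIV_diff DERIV_add DERIV_sum t d1 d2)
  then have "- deriv (\<lambda>s. remainder m s k) 0 =
      A - n * Ln (lam k) + (\<Sum>p\<in>{1..m}. (\<Sum>j\<in>J. z j ^ p) / of_nat p * (1 / lam k ^ p))"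
    by (simp add: DERIV_imp_deriv)
  also have "(\<Sum>p\<in>{1..m}. (\<Sum>j\<in>J. z j ^ p) / of_nat p * (1 / lam k ^ p)) =
      (\<Sum>j\<in>J. \<Sum>l=1..m. z j ^ l / (of_nat l * lam k ^ l))"
    by (subst sum.swap) (simp add: sum_divide_distrib)
  also have "A - n * Ln (lam k) = (\<Sum>j\<in>J. L j k - Ln (lam k))"
    by (simp add: A_def n_def sum_subtractf)
  finally have "exp (- deriv (\<lambda>s. remainder m s k) 0) =
      (\<Prod>j\<in>J. exp (L j k - Ln (lam k)) * exp (\<Sum>l=1..m. z j ^ l / (of_nat l * lam k ^ l)))"
    by (simp add: exp_add exp_sum[OF finite_J] prod.distrib)
  also have "\<dots> = (\<Prod>j\<in>J. (1 - z j / lam k) * exp (\<Sum>l=1..m. z j ^ l / (of_nat l * lam k ^ l)))"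
  proof (rule prod.cong)
    fix j assume "j \<in> J"
    then have "exp (L j k) = lam k - z j" using branch k by (auto simp: log_branch_def)
    then have "exp (L j k - Ln (lam k)) = 1 - z j / lam k"
      using nonzero[OF k] by (simp add: exp_diff diff_divide_distrib)
    then show "exp (L j k - Ln (lam k)) * exp (\<Sum>l=1..m. z j ^ l / (of_nat l * lam k ^ l)) =
      (1 - z j / lam k) * exp (\<Sum>l=1..m. z j ^ l / (of_nat l * lam k ^ l))" by simp
  qed simp
  finally show ?thesis .
qed

text \<open>The Weierstrass factors enter through the limit \<open>W\<close> of joint products over
  \<open>J\<close>. Splitting \<open>W\<close> into one product per point requires convergence for
  each point, which this same lemma provides for singletons.\<close>

lemma D_reg_product:
  assumes Z: "mero_continuation \<mu> (zeta_seq I lam) UNIV Z" "Z nicely_meromorphic_on UNIV"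
    and poles: "\<And>p. \<exists>\<rho> h. h analytic_on {p} \<and> (\<forall>\<^sub>F s in at p. Z s = \<rho> / (s - p) + h s) \<and> (p = 0 \<longrightarrow> \<rho> = 0)"
    and m: "real m + 1 > \<mu>"
  obtains W where
    "((\<lambda>X. \<Prod>k\<in>X. \<Prod>j\<in>J. (1 - z j / lam k) * exp (\<Sum>l=1..m. z j ^ l / (of_nat l * lam k ^ l))) \<longlongrightarrow> W)
       (finite_subsets_at_top I)"
    "D_reg I \<mu> J L = exp (- of_nat (card J) * deriv Z 0
        - (\<Sum>p=1..m. (\<Sum>j\<in>J. z j ^ p) / of_nat p * FP Z (of_nat p))
        - 1 / of_nat (card J) * (\<Sum>p=1..m. fps_nth (log_sum_fps J z ^ 2) p / 2 * residue Z (of_nat p))) * W"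
proof -
  define n where "n = (of_nat (card J) :: complex)"
  have n0: "n \<noteq> 0" "Re n = real (card J)" "Im n = 0" using card_J by (auto simp: n_def)
  define R where "R = (\<lambda>P s. \<Sum>\<^sub>\<infinity>k\<in>I. remainder P s k)"
  define F where "F = (\<lambda>P s. (\<Sum>p\<le>P. taylor_coeff J z p s * Z (n * s + of_nat p)) + R P s)"
  define b where "b = (\<lambda>P. (\<mu> - real P - 1) / real (card J))"
  have R_an: "R P analytic_on {s. Re s > b P}" for P
    unfolding R_def b_def using remainder_sum_holomorphic half_plane_Re_gt by (simp add: analytic_on_open)
  have F_mero: "F P meromorphic_on {s. Re s > b P}" for P
    unfolding F_def
  proof (intro meromorphic_intros)
    show "(\<lambda>s. Z (n * s + of_nat p)) meromorphic_on {s. Re s > b P}" for p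
      by (rule meromorphic_on_compose[of Z UNIV])
         (use Z(1) in \<open>auto simp: mero_continuation_def intro!: analytic_intros\<close>)
    show "taylor_coeff J z p meromorphic_on {s. Re s > b P}" for p
    proof -
      have "taylor_coeff J z p analytic_on UNIV"
        using taylor_coeff_holomorphic analytic_on_open[OF open_UNIV] by blast
      then show ?thesis by (meson analytic_on_subset analytic_on_imp_meromorphic_on subset_UNIV)
    qed
    show "R P meromorphic_on {s. Re s > b P}"
      by (rule analytic_on_imp_meromorphic_on[OF R_an])
  qed
  have F_eq: "F P s = shifted_zeta I J L s" if s: "Re s > \<mu> / real (card J)" for P s
  proof -
    have "real (card J) * Re s > \<mu>" using s card_J by (simp add: field_simps)
    then have "Re (n * s + of_nat p) > \<mu>" for p by (simp add: n0)
    then have "Z (n * s + of_nat p) = zeta_seq I lam (n * s + of_nat p)" for p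
      using Z(1) by (auto simp: mero_continuation_def)
    then show ?thesis unfolding shifted_zeta_eq[OF s, of P] F_def R_def n_def by simp
  qed
  obtain G where G: "mero_continuation (\<mu> / real (card J)) (shifted_zeta I J L) UNIV G"
    "G nicely_meromorphic_on UNIV"
  proof (rule meromorphic_continuation_glue[OF shifted_zeta_holomorphic])
    fix a
    obtain P :: nat where "real P > \<mu> - 1 - real (card J) * a" using reals_Archimedean2 by blast
    then have "b P < a" using card_J by (simp add: b_def field_simps)
    then show "\<exists>F. F meromorphic_on {s. Re s > a} \<and>
        (\<forall>s. Re s > max (\<mu> / real (card J)) a \<longrightarrow> F s = shifted_zeta I J L s)"
      using F_eq by (intro exI[of _ "F P"]) (auto intro!: meromorphic_on_subset[OF F_mero[of P]])
  qed
  \<comment> \<open>Here \<open>m + 1 > \<mu>\<close> enters: the half-plane of \<open>F m\<close>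
    contains \<open>0\<close>.\<close>
  have b0: "b m < 0" using m card_J by (simp add: b_def field_simps)
  have "b m \<le> \<mu> / real (card J)" using card_J by (simp add: b_def field_simps)
  then have "mero_continuation (\<mu> / real (card J)) (shifted_zeta I J L) {s. Re s > b m} (F m)"
    unfolding mero_continuation_def using half_plane_Re_gt F_mero F_eq by auto
  from mero_continuation_eq_at[OF this G(1) subset_UNIV, of 0] b0
  have GF: "\<forall>\<^sub>F s in at 0. F m s = G s" by simp
  obtain \<rho> h where h: "\<And>p. h p analytic_on {p}" "\<And>p. \<forall>\<^sub>F s in at p. Z s = \<rho> p / (s - p) + h p s"
    and \<rho>0: "\<rho> 0 = 0"
    using poles by metis
  \<comment> \<open>Regular form of \<open>F m\<close> near \<open>0\<close>: the zero of
    \<open>taylor_coeff\<close> cancels the pole \<open>\<rho> p / (n * s)\<close> of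
    \<open>Z (n * s + p)\<close>. What is left is \<open>taylor_quot\<close> times
    \<open>\<rho> p / n\<close>, the origin of the weight \<open>1 / n\<close>.\<close>
  define g where "g = (\<lambda>s. h 0 (n * s) + (\<Sum>p=1..m. taylor_quot J z p s * \<rho> (of_nat p) / n
      + s * taylor_quot J z p s * h (of_nat p) (n * s + of_nat p)) + R m s)"
  have ev: "\<forall>\<^sub>F s in at 0. Z (n * s + p) = \<rho> p / (n * s) + h p (n * s + p)" for p
  proof -
    have "filterlim (\<lambda>s. n * s + p) (at p) (at 0)"
    proof (rule filterlim_atI)
      have "((\<lambda>s. n * s + p) \<longlongrightarrow> n * 0 + p) (at 0)" by (intro tendsto_intros)
      then show "((\<lambda>s. n * s + p) \<longlongrightarrow> p) (at 0)" by simp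
      show "\<forall>\<^sub>F s in at 0. n * s + p \<noteq> p" using n0 by (auto simp: eventually_at_filter)
    qed
    from eventually_compose_filterlim[OF h(2) this] show ?thesis by simp
  qed
  have FG: "\<forall>\<^sub>F s in at 0. F m s = g s"
  proof -
    have "\<forall>\<^sub>F s in at 0. \<forall>p\<in>{..m}. Z (n * s + of_nat p) = \<rho> (of_nat p) / (n * s) + h (of_nat p) (n * s + of_nat p)"
      using ev eventually_ball_finite[of "{..m}" "\<lambda>s p. Z (n * s + of_nat p) = \<rho> (of_nat p) / (n * s) + h (of_nat p) (n * s + of_nat p)" "at 0"]
      by simp
    moreover have "\<forall>\<^sub>F s in at (0::complex). s \<noteq> 0" by (simp add: eventually_at_filter)
    ultimately show ?thesis
    proof eventually_elim
      case (elim s)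
      have split: "{..m} = insert 0 {1..m}" by auto
      have "(\<Sum>p\<in>{1..m}. taylor_coeff J z p s * Z (n * s + of_nat p)) =
          (\<Sum>p\<in>{1..m}. taylor_quot J z p s * \<rho> (of_nat p) / n
            + s * taylor_quot J z p s * h (of_nat p) (n * s + of_nat p))"
      proof (rule sum.cong)
        fix p assume p: "p \<in> {1..m}"
        then have Zp: "Z (n * s + of_nat p) = \<rho> (of_nat p) / (n * s) + h (of_nat p) (n * s + of_nat p)"
          using elim by auto
        show "taylor_coeff J z p s * Z (n * s + of_nat p) = taylor_quot J z p s * \<rho> (of_nat p) / n
            + s * taylor_quot J z p s * h (of_nat p) (n * s + of_nat p)"
          unfolding Zp using p elim(2) n0(1) by (simp add: taylor_coeff_eq_quot distrib_left)
      qed simp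
      moreover have "Z (n * s) = h 0 (n * s)" using elim(1)[rule_format, of 0] \<rho>0 by simp
      ultimately show ?case unfolding F_def g_def split by simp
    qed
  qed
  define D where "D = (\<Sum>\<^sub>\<infinity>k\<in>I. deriv (\<lambda>s. remainder m s k) 0)"
  have R_der: "(R m has_field_derivative D) (at 0)"
    and D_sum: "((\<lambda>k. deriv (\<lambda>s. remainder m s k) 0) has_sum D) I"
    unfolding R_def D_def using m remainder_infsum(2,3)[of 0 m] by (auto intro: has_sum_infsum)
  have h_der: "((\<lambda>s. h p (n * s + p)) has_field_derivative deriv (h p) p * n) (at 0)" for p
  proof -
    have "(h p has_field_derivative deriv (h p) p) (at (n * 0 + p))"
      using analytic_derivI[OF h(1)[of p]] by simp
    moreover have "((\<lambda>s. n * s + p) has_field_derivative n) (at 0)"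
      by (auto intro!: derivative_eq_intros)
    ultimately show ?thesis by (rule DERIV_chain2)
  qed
  have h_der0: "((\<lambda>s. h 0 (n * s)) has_field_derivative deriv (h 0) 0 * n) (at 0)"
    using h_der[of 0] by simp
  \<comment> \<open>A priori \<open>Z\<close> and \<open>h 0\<close> agree only off
    \<open>0\<close>. The normalization of \<open>Z\<close> extends this to \<open>0\<close> itself,
    without which the derivatives could not be compared.\<close>
  have Z0: "deriv (h 0) 0 = deriv Z 0"
  proof -
    have ev0: "\<forall>\<^sub>F s in at 0. Z s = h 0 s" using h(2)[of 0] \<rho>0 by simp
    have "\<not> is_pole Z 0"
      using is_pole_cong[OF ev0 refl] analytic_at_imp_no_pole[OF h(1)[of 0]] by simp
    then have "Z analytic_on {0}" by (intro nicely_meromorphic_on_imp_analytic_at[OF Z(2)]) auto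
    then have "Z \<midarrow>0\<rightarrow> Z 0" using analytic_at_imp_isCont isContD by blast
    moreover have "h 0 \<midarrow>0\<rightarrow> h 0 0" using h(1)[of 0] analytic_at_imp_isCont isContD by blast
    ultimately have "Z 0 = h 0 0" using tendsto_cong[OF ev0] LIM_unique by blast
    with ev0 have "\<forall>\<^sub>F s in nhds 0. h 0 s = Z s"
      by (auto simp: eventually_nhds_conv_at elim: eventually_mono)
    then show ?thesis by (intro deriv_cong_ev) auto
  qed
  have FPh: "FP Z (of_nat p) = h (of_nat p) (of_nat p)" "residue Z (of_nat p) = \<rho> (of_nat p)" for p
    using simple_pole_residue_FP[OF h(1) h(2), of "of_nat p"] by auto
  have t_der: "((\<lambda>s. taylor_quot J z p s * \<rho> (of_nat p) / n
      + s * taylor_quot J z p s * h (of_nat p) (n * s + of_nat p)) has_field_derivative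
     fps_nth (log_sum_fps J z ^ 2) p / 2 * residue Z (of_nat p) / n + (\<Sum>j\<in>J. z j ^ p) / of_nat p * FP Z (of_nat p)) (at 0)"
    if p: "p \<in> {1..m}" for p
  proof -
    note DERIV_add[OF
        DERIV_cdivide[OF DERIV_cmult_right[OF taylor_quot_deriv_0[of J z p], where c = "\<rho> (of_nat p)"], where c = n]
        DERIV_mult[OF DERIV_mult[OF DERIV_ident taylor_quot_deriv_0[of J z p]] h_der[of "of_nat p"]]]
    then show ?thesis using p by (simp add: FPh taylor_quot_0)
  qed
  have g_der: "(g has_field_derivative (deriv Z 0 * n + (\<Sum>p=1..m. fps_nth (log_sum_fps J z ^ 2) p / 2 * residue Z (of_nat p) / n
      + (\<Sum>j\<in>J. z j ^ p) / of_nat p * FP Z (of_nat p)) + D)) (at 0)"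
    unfolding g_def Z0[symmetric] by (intro DERIV_add DERIV_sum h_der0 t_der R_der)
  have quot_an: "taylor_quot J z p analytic_on {0}" for p
    unfolding taylor_quot_def by (intro analytic_intros) (simp_all del: fact_Suc)
  have "g analytic_on {0}"
    unfolding g_def
  proof (intro analytic_intros quot_an)
    have aff: "(\<lambda>s. n * s + p) analytic_on {0}" for p by (intro analytic_intros)
    have hc: "(\<lambda>s. h p (n * s + p)) analytic_on {0}" for p
      using analytic_on_compose_gen[OF aff h(1), of p] by (auto simp: o_def)
    show "(\<lambda>s. h (of_nat p) (n * s + of_nat p)) analytic_on {0}" for p using hc .
    show "(\<lambda>s. h 0 (n * s)) analytic_on {0}" using hc[of 0] by simp
    show "R m analytic_on {0}" by (rule analytic_on_subset[OF R_an]) (use b0 in auto)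
  qed (use n0 in auto)
  moreover have "\<forall>\<^sub>F s in at 0. G s = g s" using GF FG by eventually_elim simp
  ultimately have Dreg: "D_reg I \<mu> J L = exp (- deriv g 0)"
    unfolding D_reg_def by (rule zeta_reg_prod_eq[OF G(1) _ _ G(2)])
  \<comment> \<open>Convergence of the product is inherited from the sum of derivatives:
    \<open>exp\<close> is continuous and sends partial sums to partial products.\<close>
  have "((\<lambda>X. exp (- (\<Sum>k\<in>X. deriv (\<lambda>s. remainder m s k) 0))) \<longlongrightarrow> exp (- D)) (finite_subsets_at_top I)"
    using D_sum unfolding has_sum_def by (intro tendsto_intros)
  moreover have "\<forall>\<^sub>F X in finite_subsets_at_top I. exp (- (\<Sum>k\<in>X. deriv (\<lambda>s. remainder m s k) 0)) =
      (\<Prod>k\<in>X. \<Prod>j\<in>J. (1 - z j / lam k) * exp (\<Sum>l=1..m. z j ^ l / (of_nat l * lam k ^ l)))"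
  proof (rule eventually_finite_subsets_at_top_weakI)
    fix X assume X: "finite X" "X \<subseteq> I"
    have "exp (- (\<Sum>k\<in>X. deriv (\<lambda>s. remainder m s k) 0)) = (\<Prod>k\<in>X. exp (- deriv (\<lambda>s. remainder m s k) 0))"
      using X(1) by (simp add: sum_negf[symmetric] exp_sum)
    also have "\<dots> = (\<Prod>k\<in>X. \<Prod>j\<in>J. (1 - z j / lam k) * exp (\<Sum>l=1..m. z j ^ l / (of_nat l * lam k ^ l)))"
      by (intro prod.cong exp_remainder_deriv_0) (use X in auto)
    finally show "exp (- (\<Sum>k\<in>X. deriv (\<lambda>s. remainder m s k) 0)) =
      (\<Prod>k\<in>X. \<Prod>j\<in>J. (1 - z j / lam k) * exp (\<Sum>l=1..m. z j ^ l / (of_nat l * lam k ^ l)))" .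
  qed
  ultimately have lim: "((\<lambda>X. \<Prod>k\<in>X. \<Prod>j\<in>J. (1 - z j / lam k) * exp (\<Sum>l=1..m. z j ^ l / (of_nat l * lam k ^ l)))
      \<longlongrightarrow> exp (- D)) (finite_subsets_at_top I)"
    by (rule Lim_transform_eventually)
  show ?thesis
  proof (rule that[OF lim])
    have "- deriv g 0 = - n * deriv Z 0
        - (\<Sum>p=1..m. (\<Sum>j\<in>J. z j ^ p) / of_nat p * FP Z (of_nat p))
        - 1 / n * (\<Sum>p=1..m. fps_nth (log_sum_fps J z ^ 2) p / 2 * residue Z (of_nat p)) + - D"
      unfolding DERIV_imp_deriv[OF g_der] by (simp add: sum.distrib sum_divide_distrib)
    then show "D_reg I \<mu> J L = exp (- of_nat (card J) * deriv Z 0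
        - (\<Sum>p=1..m. (\<Sum>j\<in>J. z j ^ p) / of_nat p * FP Z (of_nat p))
        - 1 / of_nat (card J) * (\<Sum>p=1..m. fps_nth (log_sum_fps J z ^ 2) p / 2 * residue Z (of_nat p))) * exp (- D)"
      unfolding Dreg n_def by (simp only: exp_add)
  qed
qed

end

section \<open>The zeta regularized product\<close>

text \<open>Partial fractions: \<open>1 / (r * (p - r))\<close> is
  \<open>(1 / r + 1 / (p - r)) / p\<close>, and reflecting \<open>r\<close> to \<open>p - r\<close>
  shows that both halves sum to the same harmonic number.\<close>

lemma sum_inverse_mult_reflected:
  assumes "p > 0"
  shows "(\<Sum>r=1..p-1. 1 / (of_nat r * of_nat (p - r))) = (2 * harm (p - 1) / of_nat p :: complex)"
proof -
  have "(\<Sum>r=1..p-1. 1 / (of_nat r * of_nat (p - r)) :: complex) =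
      (\<Sum>r=1..p-1. (inverse (of_nat r) + inverse (of_nat (p - r))) / of_nat p)"
  proof (rule sum.cong)
    fix r assume "r \<in> {1..p-1}"
    then have "(of_nat r :: complex) \<noteq> 0" "(of_nat (p - r) :: complex) \<noteq> 0"
      "(of_nat p :: complex) = of_nat r + of_nat (p - r)" "(of_nat p :: complex) \<noteq> 0"
      using assms by (auto simp flip: of_nat_add)
    then show "1 / (of_nat r * of_nat (p - r)) = (inverse (of_nat r) + inverse (of_nat (p - r))) / (of_nat p :: complex)"
      by (simp add: divide_simps del: of_nat_diff)
  qed simp
  also have "(\<Sum>r=1..p-1. (inverse (of_nat r) + inverse (of_nat (p - r))) / of_nat p) =
      (harm (p - 1) + (\<Sum>r=1..p-1. inverse (of_nat (p - r)))) / (of_nat p :: complex)"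
    by (simp only: sum_divide_distrib[symmetric] sum.distrib harm_def)
  also have "(\<Sum>r=1..p-1. inverse (of_nat (p - r)) :: complex) = harm (p - 1)"
    unfolding harm_def by (subst sum.atLeastAtMost_rev) (rule sum.cong, use assms in auto)
  finally show ?thesis by simp
qed

lemma sum_symmetric_square:
  fixes S :: "'a :: linorder \<Rightarrow> 'a \<Rightarrow> complex"
  assumes J: "finite J" and sym: "\<And>a b. S a b = S b a"
  shows "(\<Sum>a\<in>J. \<Sum>b\<in>J. S a b) = (\<Sum>a\<in>J. S a a) + 2 * (\<Sum>(a, b)\<in>{(a, b). a \<in> J \<and> b \<in> J \<and> a < b}. S a b)"
proof -
  define U where "U = {(a, b). a \<in> J \<and> b \<in> J \<and> a < b}"
  have U: "finite U" by (rule finite_subset[of _ "J \<times> J"]) (use J in \<open>auto simp: U_def\<close>)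
  have decomp: "J \<times> J = (\<lambda>a. (a, a)) ` J \<union> (U \<union> prod.swap ` U)"
    by (auto simp: U_def image_iff)
  have "(\<Sum>a\<in>J. \<Sum>b\<in>J. S a b) = (\<Sum>(a, b)\<in>J \<times> J. S a b)"
    by (rule sum.cartesian_product)
  also have "\<dots> = (\<Sum>(a, b)\<in>(\<lambda>a. (a, a)) ` J. S a b) + ((\<Sum>(a, b)\<in>U. S a b) + (\<Sum>(a, b)\<in>prod.swap ` U. S a b))"
    unfolding decomp using J U
    by (subst sum.union_disjoint, simp, simp, force simp: U_def)
       (subst sum.union_disjoint, simp, simp, force simp: U_def, simp)
  also have "(\<Sum>(a, b)\<in>(\<lambda>a. (a, a)) ` J. S a b) = (\<Sum>a\<in>J. S a a)"
    by (subst sum.reindex) (auto simp: inj_on_def)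
  also have "(\<Sum>(a, b)\<in>prod.swap ` U. S a b) = (\<Sum>(a, b)\<in>U. S a b)"
    by (subst sum.reindex) (auto simp: inj_on_def sym intro!: sum.cong)
  finally show ?thesis unfolding U_def by simp
qed

text \<open>The Cauchy product is a symmetric double sum over pairs of points. Its diagonal is
  evaluated by \<open>sum_inverse_mult_reflected\<close>; the rest counts each unordered pair twice,
  which the division by \<open>2\<close> undoes.\<close>

lemma fps_nth_log_sum_fps_square:
  fixes J :: "'j :: linorder set"
  assumes J: "finite J" and p: "p > 0"
  shows "fps_nth (log_sum_fps J z ^ 2) p / 2 =
    (\<Sum>j\<in>J. harm (p - 1) / of_nat p * z j ^ p) +
    (\<Sum>(j1, j2)\<in>{(a, b). a \<in> J \<and> b \<in> J \<and> a < b}.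
       \<Sum>r=1..p-1. z j1 ^ r * z j2 ^ (p - r) / (of_nat r * of_nat (p - r)))"
proof -
  define S where "S = (\<lambda>a b. \<Sum>r=1..p-1. z a ^ r * z b ^ (p - r) / (of_nat r * of_nat (p - r)))"
  have sym: "S a b = S b a" for a b
    unfolding S_def by (subst sum.atLeastAtMost_rev) (rule sum.cong, use p in \<open>auto simp: mult_ac\<close>)
  have diag: "S a a = 2 * (harm (p - 1) / of_nat p * z a ^ p)" for a
  proof -
    have "S a a = z a ^ p * (\<Sum>r=1..p-1. 1 / (of_nat r * of_nat (p - r)))"
      unfolding S_def sum_distrib_left by (rule sum.cong) (auto simp flip: power_add)
    then show ?thesis using sum_inverse_mult_reflected[OF p] by simp
  qed
  have "fps_nth (log_sum_fps J z ^ 2) p =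
      (\<Sum>i=0..p. ((\<Sum>j\<in>J. z j ^ i) / of_nat i) * ((\<Sum>j\<in>J. z j ^ (p - i)) / of_nat (p - i)))"
    by (simp add: power2_eq_square fps_mult_nth log_sum_fps_def)
  \<comment> \<open>The end terms \<open>i = 0\<close> and \<open>i = p\<close> vanish because
    division by zero yields \<open>0\<close>.\<close>
  also have "\<dots> = (\<Sum>i=1..p-1. ((\<Sum>j\<in>J. z j ^ i) / of_nat i) * ((\<Sum>j\<in>J. z j ^ (p - i)) / of_nat (p - i)))"
    by (rule sum.mono_neutral_right) auto
  also have "\<dots> = (\<Sum>i=1..p-1. \<Sum>a\<in>J. \<Sum>b\<in>J. z a ^ i * z b ^ (p - i) / (of_nat i * of_nat (p - i)))"
    by (simp add: sum_product sum_divide_distrib)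
  also have "\<dots> = (\<Sum>a\<in>J. \<Sum>b\<in>J. S a b)"
    unfolding S_def by (subst sum.swap) (rule sum.cong[OF refl], rule sum.swap)
  also have "\<dots> = 2 * (\<Sum>j\<in>J. harm (p - 1) / of_nat p * z j ^ p) +
      2 * (\<Sum>(a, b)\<in>{(a, b). a \<in> J \<and> b \<in> J \<and> a < b}. S a b)"
    using sum_symmetric_square[of J S, OF J sym] by (simp only: diag sum_distrib_left)
  finally show ?thesis by (simp add: S_def)
qed

lemma sum_log_sum_fps_square:
  fixes J :: "'j :: linorder set"
  assumes J: "finite J"
  shows "(\<Sum>p=1..m. fps_nth (log_sum_fps J z ^ 2) p / 2 * c p) =
    (\<Sum>j\<in>J. \<Sum>l=2..m. c l * harm (l - 1) / of_nat l * z j ^ l) +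
    (\<Sum>(j1, j2)\<in>{(a, b). a \<in> J \<and> b \<in> J \<and> a < b}. \<Sum>l=2..m. \<Sum>r=1..l-1.
       c l * z j1 ^ r * z j2 ^ (l - r) / (of_nat r * of_nat (l - r)))"
proof -
  have "(\<Sum>p=1..m. fps_nth (log_sum_fps J z ^ 2) p / 2 * c p) =
      (\<Sum>l=2..m. fps_nth (log_sum_fps J z ^ 2) l / 2 * c l)"
  proof (rule sum.mono_neutral_right)
    show "\<forall>i\<in>{1..m} - {2..m}. fps_nth (log_sum_fps J z ^ 2) i / 2 * c i = 0"
    proof
      fix i assume "i \<in> {1..m} - {2..m}"
      \<comment> \<open>For exponent \<open>1\<close> both parts are empty (\<open>harm 0\<close>
        and the range \<open>1..0\<close>), hence the sums over residues start at
        \<open>l = 2\<close>.\<close>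
      then have "i = 1" by auto
      then show "fps_nth (log_sum_fps J z ^ 2) i / 2 * c i = 0"
        using fps_nth_log_sum_fps_square[OF J, of 1 z] by (simp add: harm_def)
    qed
  qed auto
  also have "\<dots> = (\<Sum>l=2..m. (\<Sum>j\<in>J. c l * harm (l - 1) / of_nat l * z j ^ l) +
      (\<Sum>(j1, j2)\<in>{(a, b). a \<in> J \<and> b \<in> J \<and> a < b}. \<Sum>r=1..l-1.
       c l * z j1 ^ r * z j2 ^ (l - r) / (of_nat r * of_nat (l - r))))"
  proof (rule sum.cong)
    fix l assume "l \<in> {2..m}"
    then have "l > 0" by auto
    note eq = fps_nth_log_sum_fps_square[OF J this, of z]
    show "fps_nth (log_sum_fps J z ^ 2) l / 2 * c l = (\<Sum>j\<in>J. c l * harm (l - 1) / of_nat l * z j ^ l) +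
      (\<Sum>(j1, j2)\<in>{(a, b). a \<in> J \<and> b \<in> J \<and> a < b}. \<Sum>r=1..l-1.
       c l * z j1 ^ r * z j2 ^ (l - r) / (of_nat r * of_nat (l - r)))"
      unfolding eq case_prod_unfold distrib_right sum_distrib_right by (simp add: mult_ac)
  qed simp
  also have "\<dots> = (\<Sum>j\<in>J. \<Sum>l=2..m. c l * harm (l - 1) / of_nat l * z j ^ l) +
    (\<Sum>(j1, j2)\<in>{(a, b). a \<in> J \<and> b \<in> J \<and> a < b}. \<Sum>l=2..m. \<Sum>r=1..l-1.
       c l * z j1 ^ r * z j2 ^ (l - r) / (of_nat r * of_nat (l - r)))"
    unfolding sum.distrib case_prod_unfold
    by (intro arg_cong2[of _ _ _ _ "(+)"]) (rule sum.swap)+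
  finally show ?thesis .
qed

theorem theorem2p3:
  fixes I :: "'i set" and lam :: "'i \<Rightarrow> complex" and \<mu> :: real
    and c :: "nat \<Rightarrow> complex" and e :: "nat \<Rightarrow> real"
    and m n :: nat and z :: "nat \<Rightarrow> complex"
    and L M :: "nat \<Rightarrow> 'i \<Rightarrow> complex"
    and \<zeta> :: "complex \<Rightarrow> complex"
  assumes countable: "countable I"
    and nonzero: "\<And>k. k \<in> I \<Longrightarrow> lam k \<noteq> 0"
    and order: "has_order I lam \<mu>" and order_pos: "\<mu> > 0"
    and theta_summable: "\<And>t. t > 0 \<Longrightarrow> (\<lambda>k. exp (- of_real t * lam k)) summable_on I"
    and mellin_integrable: "\<And>s. Re s > \<mu> \<Longrightarrow>
          set_integrable lborel {0<..} (\<lambda>t. theta_seq I lam t * of_real t powr (s - 1))"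
    and mellin: "\<And>s. Re s > \<mu> \<Longrightarrow>
          zeta_seq I lam s =
            1 / Gamma s * (LINT t:{0<..}|lborel. theta_seq I lam t * of_real t powr (s - 1))"
    and expansion: "asymp_expansion_at_0 (theta_seq I lam) c e"
    and exponents: "strict_mono e" "e 0 < 0" "filterlim e at_top sequentially" "- e 0 = \<mu>"
    and regularizable: "regularizable \<mu> (zeta_seq I lam)"
    and zeta: "\<zeta> = zeta_ext I lam \<mu>"
    and m: "m = nat \<lfloor>\<mu>\<rfloor>"
    and n: "n \<ge> 1"
    and z: "\<And>j. j \<in> {1..n} \<Longrightarrow> z j \<notin> lam ` I"
    and branch_L: "\<And>j. j \<in> {1..n} \<Longrightarrow> log_branch I lam (z j) (L j)"
    and branch_M: "\<And>j. j \<in> {1..n} \<Longrightarrow> log_branch I lam (z j) (M j)"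
  shows "D_reg I \<mu> {1..n} L =
           exp (- of_nat n * deriv \<zeta> 0
                - (\<Sum>j=1..n. \<Sum>l=1..m. FP \<zeta> (of_nat l) / of_nat l * z j ^ l)
                - 1 / of_nat n *
                  (\<Sum>j=1..n. \<Sum>l=2..m. residue \<zeta> (of_nat l) * harm (l - 1) / of_nat l * z j ^ l)
                - 1 / of_nat n *
                  (\<Sum>(j1, j2) \<in> {(j1, j2). 1 \<le> j1 \<and> j1 < j2 \<and> j2 \<le> n}. \<Sum>l=2..m. \<Sum>r=1..l-1.
                     residue \<zeta> (of_nat l) * z j1 ^ r * z j2 ^ (l - r) / (of_nat r * of_nat (l - r))))
           * (\<Prod>j=1..n. weierstrass_prod I lam m (z j))
         \<and>
         D_reg I \<mu> {1..n} L =
           (\<Prod>j=1..n. D_reg I \<mu> {j} M) *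
           exp ((1 - 1 / of_nat n) *
                  (\<Sum>j=1..n. \<Sum>l=2..m. residue \<zeta> (of_nat l) * harm (l - 1) / of_nat l * z j ^ l)
                - 1 / of_nat n *
                  (\<Sum>(j1, j2) \<in> {(j1, j2). 1 \<le> j1 \<and> j1 < j2 \<and> j2 \<le> n}. \<Sum>l=2..m. \<Sum>r=1..l-1.
                     residue \<zeta> (of_nat l) * z j1 ^ r * z j2 ^ (l - r) / (of_nat r * of_nat (l - r))))"
proof -
  interpret sequence_of_order I lam \<mu> using nonzero order order_pos by unfold_locales
  define A where "A = (\<lambda>j. \<Sum>l=1..m. FP \<zeta> (of_nat l) / of_nat l * z j ^ l)"
  define B where "B = (\<lambda>j. \<Sum>l=2..m. residue \<zeta> (of_nat l) * harm (l - 1) / of_nat l * z j ^ l)"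
  define C where "C = (\<Sum>(j1, j2) \<in> {(j1, j2). 1 \<le> j1 \<and> j1 < j2 \<and> j2 \<le> n}. \<Sum>l=2..m. \<Sum>r=1..l-1.
                     residue \<zeta> (of_nat l) * z j1 ^ r * z j2 ^ (l - r) / (of_nat r * of_nat (l - r)))"
  define E where "E = (\<lambda>j k. (1 - z j / lam k) * exp (\<Sum>l=1..m. z j ^ l / (of_nat l * lam k ^ l)))"
  have Z: "mero_continuation \<mu> (zeta_seq I lam) UNIV \<zeta>" "\<zeta> nicely_meromorphic_on UNIV"
    and poles: "\<And>p. \<exists>\<rho> h. h analytic_on {p} \<and> (\<forall>\<^sub>F s in at p. \<zeta> s = \<rho> / (s - p) + h s) \<and> (p = 0 \<longrightarrow> \<rho> = 0)"
    unfolding zeta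
    by (rule zeta_ext_simple_poles[OF mellin_integrable mellin expansion exponents(1,3,4)]; assumption)+
  have m1: "real m + 1 > \<mu>" using order_pos unfolding m by linarith
  have linear: "(\<Sum>p=1..m. (\<Sum>j\<in>J. z j ^ p) / of_nat p * FP \<zeta> (of_nat p)) = (\<Sum>j\<in>J. A j)" for J
    unfolding A_def by (subst sum.swap) (simp add: sum_divide_distrib sum_distrib_right sum_distrib_left mult_ac)
  have all: "shifted_sequence I lam \<mu> {1..n} z L"
    using branch_L n by unfold_locales auto
  obtain W where W: "((\<lambda>X. \<Prod>k\<in>X. \<Prod>j\<in>{1..n}. E j k) \<longlongrightarrow> W) (finite_subsets_at_top I)"
    and D: "D_reg I \<mu> {1..n} L = exp (- of_nat n * deriv \<zeta> 0 - (\<Sum>j=1..n. A j)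
      - 1 / of_nat n * ((\<Sum>j=1..n. B j) + C)) * W"
  proof -
    have pairs: "{(a, b). a \<in> {1..n} \<and> b \<in> {1..n} \<and> a < b} = {(j1, j2). 1 \<le> j1 \<and> j1 < j2 \<and> j2 \<le> n}"
      by auto
    show ?thesis
    proof (rule shifted_sequence.D_reg_product[OF all Z poles m1])
      fix W
      assume W: "((\<lambda>X. \<Prod>k\<in>X. \<Prod>j\<in>{1..n}. (1 - z j / lam k) *
          exp (\<Sum>l=1..m. z j ^ l / (of_nat l * lam k ^ l))) \<longlongrightarrow> W) (finite_subsets_at_top I)"
        and D: "D_reg I \<mu> {1..n} L = exp (- of_nat (card {1..n}) * deriv \<zeta> 0
          - (\<Sum>p=1..m. (\<Sum>j=1..n. z j ^ p) / of_nat p * FP \<zeta> (of_nat p))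
          - 1 / of_nat (card {1..n}) *
            (\<Sum>p=1..m. fps_nth (log_sum_fps {1..n} z ^ 2) p / 2 * residue \<zeta> (of_nat p))) * W"
      show ?thesis
      proof (rule that)
        show "((\<lambda>X. \<Prod>k\<in>X. \<Prod>j\<in>{1..n}. E j k) \<longlongrightarrow> W) (finite_subsets_at_top I)"
          using W unfolding E_def .
        show "D_reg I \<mu> {1..n} L = exp (- of_nat n * deriv \<zeta> 0 - (\<Sum>j=1..n. A j)
            - 1 / of_nat n * ((\<Sum>j=1..n. B j) + C)) * W"
          using D unfolding linear sum_log_sum_fps_square[OF finite_atLeastAtMost] pairs B_def C_def
          by (simp only: card_atLeastAtMost diff_Suc_1)
      qed
    qed
  qed
  \<comment> \<open>For a single point there are no pairs and the weight \<open>1 / n\<close>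
    becomes \<open>1\<close>. The branches \<open>M\<close> may differ from \<open>L\<close>, but
    the limit of the Weierstrass factors depends only on \<open>z j\<close>.\<close>
  have "\<exists>w. ((\<lambda>X. \<Prod>k\<in>X. E j k) \<longlongrightarrow> w) (finite_subsets_at_top I) \<and>
      D_reg I \<mu> {j} M = exp (- deriv \<zeta> 0 - A j - B j) * w" if j: "j \<in> {1..n}" for j
  proof -
    have single: "shifted_sequence I lam \<mu> {j} z M" using branch_M j by unfold_locales auto
    obtain w where w: "((\<lambda>X. \<Prod>k\<in>X. \<Prod>j\<in>{j}. E j k) \<longlongrightarrow> w) (finite_subsets_at_top I)"
      "D_reg I \<mu> {j} M = exp (- of_nat (card {j}) * deriv \<zeta> 0 - (\<Sum>j\<in>{j}. A j)
        - 1 / of_nat (card {j}) * (\<Sum>p=1..m. fps_nth (log_sum_fps {j} z ^ 2) p / 2 * residue \<zeta> (of_nat p))) * w"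
      unfolding E_def by (rule shifted_sequence.D_reg_product[OF single Z poles m1, unfolded linear])
    have pairs: "{(a, b). a \<in> {j} \<and> b \<in> {j} \<and> a < b} = {}" by auto
    have "(\<Sum>p=1..m. fps_nth (log_sum_fps {j} z ^ 2) p / 2 * residue \<zeta> (of_nat p)) = B j"
      using sum_log_sum_fps_square[of "{j}" z "\<lambda>p. residue \<zeta> (of_nat p)" m]
      unfolding pairs by (simp add: B_def)
    then show ?thesis using w by (intro exI[of _ w]) simp
  qed
  then obtain w where w: "\<And>j. j \<in> {1..n} \<Longrightarrow> ((\<lambda>X. \<Prod>k\<in>X. E j k) \<longlongrightarrow> w j) (finite_subsets_at_top I)"
    and Dj: "\<And>j. j \<in> {1..n} \<Longrightarrow> D_reg I \<mu> {j} M = exp (- deriv \<zeta> 0 - A j - B j) * w j"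
    by metis
  have wp: "weierstrass_prod I lam m (z j) = w j" if "j \<in> {1..n}" for j
    using tendsto_Lim[OF finite_subsets_at_top_neq_bot w[OF that]]
    by (simp add: weierstrass_prod_def E_def)
  \<comment> \<open>Over finite \<open>X\<close> the joint product factors exactly, so uniqueness of
    limits identifies \<open>W\<close> with the product of the individual limits.\<close>
  have "((\<lambda>X. \<Prod>j\<in>{1..n}. \<Prod>k\<in>X. E j k) \<longlongrightarrow> (\<Prod>j=1..n. w j)) (finite_subsets_at_top I)"
    by (intro tendsto_prod w)
  then have "((\<lambda>X. \<Prod>k\<in>X. \<Prod>j\<in>{1..n}. E j k) \<longlongrightarrow> (\<Prod>j=1..n. w j)) (finite_subsets_at_top I)"
    by (subst prod.swap)
  then have W_eq: "W = (\<Prod>j=1..n. weierstrass_prod I lam m (z j))"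
    using tendsto_unique[OF finite_subsets_at_top_neq_bot W] wp by simp
  have prod_D: "(\<Prod>j=1..n. D_reg I \<mu> {j} M) =
      exp (- of_nat n * deriv \<zeta> 0 - (\<Sum>j=1..n. A j) - (\<Sum>j=1..n. B j)) * W"
  proof -
    have "(\<Prod>j=1..n. D_reg I \<mu> {j} M) = (\<Prod>j=1..n. exp (- deriv \<zeta> 0 - A j - B j) * weierstrass_prod I lam m (z j))"
      using Dj wp by (intro prod.cong) auto
    then show ?thesis
      by (simp add: prod.distrib W_eq exp_sum[symmetric] sum_subtractf)
  qed
  have "D_reg I \<mu> {1..n} L = exp (- of_nat n * deriv \<zeta> 0 - (\<Sum>j=1..n. A j)
      - 1 / of_nat n * (\<Sum>j=1..n. B j) - 1 / of_nat n * C) * W"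
    unfolding D by (simp add: algebra_simps)
  moreover have "D_reg I \<mu> {1..n} L = (\<Prod>j=1..n. D_reg I \<mu> {j} M) *
      exp ((1 - 1 / of_nat n) * (\<Sum>j=1..n. B j) - 1 / of_nat n * C)"
  proof -
    \<comment> \<open>With \<open>b\<close> the harmonic part and \<open>x = 1 / n\<close>, the
      factor \<open>1 - x\<close> corrects the full weight of \<open>b\<close> in the individual
      products to the weight \<open>1 / n\<close> in the joint one.\<close>
    have aux: "(u - a - b) + ((1 - x) * b - x * c) = u - a - x * (b + c)" for u a b c x :: complex
      by (simp add: algebra_simps)
    have "(\<Prod>j=1..n. D_reg I \<mu> {j} M) * exp ((1 - 1 / of_nat n) * (\<Sum>j=1..n. B j) - 1 / of_nat n * C) =
        exp ((- of_nat n * deriv \<zeta> 0 - (\<Sum>j=1..n. A j) - (\<Sum>j=1..n. B j)) +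
          ((1 - 1 / of_nat n) * (\<Sum>j=1..n. B j) - 1 / of_nat n * C)) * W"
      unfolding prod_D exp_add by simp
    also have "\<dots> = D_reg I \<mu> {1..n} L"
      unfolding D aux ..
    finally show ?thesis by simp
  qed
  ultimately show ?thesis unfolding A_def B_def C_def W_eq by (intro conjI)
qed

end
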